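(* Let $n\ge 4$ and let $T_n\in\mathfrak{T}_n$ be a triangular chain with length vector $(l_1,\dots,l_s)$. Let $TI$ be a bond incident degree index with edge weights $\theta_{a,b}$. Put \[\Lambda_{0}=2n\theta_{4,4}+2\theta_{2,3}+2\theta_{2,4}+2\theta_{3,4}-\theta_{3,5}-4\theta_{4,5},\] \[\Lambda_{1}=\theta_{2,5}-\theta_{2,4}+\theta_{3,3}-3\theta_{3,4}+\theta_{3,5}+3\theta_{4,4}-2\theta_{4,5},\] \[\Lambda_{2}=\theta_{3,5}-\theta_{3,4}+\theta_{4,4}-\theta_{4,5},\qquad \Lambda_{3}=2\theta_{3,4}+\theta_{3,5}-7\theta_{4,4}+4\theta_{4,5},\] \[\Lambda_{4}=2\theta_{3,5}-2\theta_{3,4}+3\theta_{4,4}-4\theta_{4,5}+\theta_{5,5},\qquad \Lambda_{5}=\theta_{4,4}-2\theta_{4,5}+\theta_{5,5}.\] Then \[TI(T_{n})= \begin{cases} \Lambda_{0}+\Lambda_{3} & \text{if } s=1,\\ \Lambda_{0}+\Lambda_{1}(\eta_{1}+\eta_{2})+\Lambda_{2}(\xi_{1}+\xi_{2})+2\Lambda_{3} & \text{if } s=2,\\ \Lambda_{0}+\Lambda_{1}(\eta_{1}+\eta_{s})+\Lambda_{2}(\xi_{1}+\xi_{s})+s\Lambda_{3}+\Lambda_{4}\sum_{i=2}^{s-1}\xi_{i}+\Lambda_{5}\sum_{i=2}^{s-1}\sigma_{i} & \text{if } s\ge 3. \end{cases}\]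
   Context: A triangular chain is a plane figure obtained by concatenating congruent equilateral triangles side to side so that every bounded (internal) region is one of these triangles, and whose characteristic graph (vertices = the triangles, two triangles adjacent iff they share a side) is a path; it is regarded as the simple graph whose vertices are the corner points of the triangles and whose edges are the sides of the triangles. A triangle is terminal if it shares a side with exactly one other triangle. A linear triangular chain is a triangular chain in which every vertex has degree at most 4. A segment of a triangular chain $T$ is a part of $T$ forming an induced subgraph which is a maximal linear triangular chain contained in $T$; a segment is terminal if it contains a terminal triangle. The length of a segment is its number of triangles. If $T$ has segments $S_1,\dots,S_s$, listed in order along the chain (so that for $s\ge 2$ the segments $S_1,S_s$ are the terminal ones), with lengths $l_i=$ length of $S_i$, then $(l_1,\dots,l_s)$ is the length vector of $T$. For $n\ge4$, $\mathfrak{T}_n$ is the set of triangular chains with $n$ triangles in which every vertex has degree at most 5. For $1\le i\le s$: $\eta_i=1$ if $l_i=3$ and $0$ otherwise; $\xi_i=1$ if $l_i=4$ and $0$ otherwise; $\sigma_i=1$ if $l_i=5$ and $0$ otherwise. A bond incident degree (BID) index is $TI(G)=\sum_{uv\in E(G)}\theta_{d_u,d_v}$, where $d_u$ is the degree of vertex $u$ and $\theta_{a,b}=\theta_{b,a}$ is a non-negative real number depending on $a,b$. *)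

theory Defs
  imports Complex_Main "HOL-Library.Product_Lexorder"
begin

text \<open>Triangular lattice: the point (a,b) stands for a + b*omega, omega = exp(i*pi/3).
  Every triangular chain is congruent to one whose triangles are unit cells of this lattice.\<close>

definition lat_adj :: "int \<times> int \<Rightarrow> int \<times> int \<Rightarrow> bool" where
  "lat_adj p q \<longleftrightarrow> (fst q - fst p, snd q - snd p) \<in> {(1,0),(-1,0),(0,1),(0,-1),(1,-1),(-1,1)}"

definition lattice_tri :: "(int \<times> int) set \<Rightarrow> bool" where
  "lattice_tri t \<longleftrightarrow> card t = 3 \<and> (\<forall>p\<in>t. \<forall>q\<in>t. p \<noteq> q \<longrightarrow> lat_adj p q)"

definition shares_side :: "(int \<times> int) set \<Rightarrow> (int \<times> int) set \<Rightarrow> bool" where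
  "shares_side t t' \<longleftrightarrow> card (t \<inter> t') = 2"

definition sides :: "(int \<times> int) set \<Rightarrow> (int \<times> int) set set" where
  "sides t = {e. e \<subseteq> t \<and> card e = 2}"

definition fig_verts :: "(int \<times> int) set list \<Rightarrow> (int \<times> int) set" where
  "fig_verts ts = \<Union>(set ts)"

definition fig_edges :: "(int \<times> int) set list \<Rightarrow> (int \<times> int) set set" where
  "fig_edges ts = \<Union>(sides ` set ts)"

definition deg :: "(int \<times> int) set list \<Rightarrow> int \<times> int \<Rightarrow> nat" where
  "deg ts u = card {e \<in> fig_edges ts. u \<in> e}"

text \<open>Bond incident degree index; theta is assumed symmetric, so using Min/Max of the
  two endpoints is just a way to name the endpoints.\<close>
definition TI :: "(nat \<Rightarrow> nat \<Rightarrow> real) \<Rightarrow> (int \<times> int) set list \<Rightarrow> real" where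
  "TI \<theta> ts = (\<Sum>e\<in>fig_edges ts. \<theta> (deg ts (Min e)) (deg ts (Max e)))"

text \<open>Edge-adjacency of lattice triangles not belonging to the chain; its connected
  components are exactly the regions of the complement of the figure.\<close>
definition missing_adj :: "(int \<times> int) set list \<Rightarrow> ((int \<times> int) set \<times> (int \<times> int) set) set" where
  "missing_adj ts = {(t,t'). lattice_tri t \<and> lattice_tri t' \<and> t \<notin> set ts \<and> t' \<notin> set ts
                              \<and> shares_side t t'}"

definition tri_chain :: "(int \<times> int) set list \<Rightarrow> bool" where
  "tri_chain ts \<longleftrightarrow> ts \<noteq> [] \<and> distinct ts \<and> (\<forall>t\<in>set ts. lattice_tri t)
     \<and> (\<forall>i j. i < j \<and> j < length ts \<longrightarrow> (shares_side (ts!i) (ts!j) \<longleftrightarrow> j = Suc i))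
     \<and> (\<forall>t. lattice_tri t \<and> t \<notin> set ts \<longrightarrow> infinite {t'. (t,t') \<in> (missing_adj ts)\<^sup>*})"

definition linear_chain :: "(int \<times> int) set list \<Rightarrow> bool" where
  "linear_chain ts \<longleftrightarrow> tri_chain ts \<and> (\<forall>u\<in>fig_verts ts. deg ts u \<le> 4)"

definition subchain :: "(int \<times> int) set list \<Rightarrow> nat \<Rightarrow> nat \<Rightarrow> (int \<times> int) set list" where
  "subchain ts i j = take (Suc j - i) (drop i ts)"

definition induced_in :: "(int \<times> int) set list \<Rightarrow> (int \<times> int) set list \<Rightarrow> bool" where
  "induced_in ts sub \<longleftrightarrow> {e \<in> fig_edges ts. e \<subseteq> fig_verts sub} = fig_edges sub"

definition lin_piece :: "(int \<times> int) set list \<Rightarrow> nat \<Rightarrow> nat \<Rightarrow> bool" where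
  "lin_piece ts i j \<longleftrightarrow> i \<le> j \<and> j < length ts \<and> linear_chain (subchain ts i j)
                         \<and> induced_in ts (subchain ts i j)"

definition segment :: "(int \<times> int) set list \<Rightarrow> nat \<Rightarrow> nat \<Rightarrow> bool" where
  "segment ts i j \<longleftrightarrow> lin_piece ts i j \<and>
     (\<forall>i' j'. lin_piece ts i' j' \<and> i' \<le> i \<and> j \<le> j' \<longrightarrow> i' = i \<and> j' = j)"

definition length_vector :: "(int \<times> int) set list \<Rightarrow> nat list" where
  "length_vector ts = map (\<lambda>(i,j). Suc j - i) (sorted_list_of_set {(i,j). segment ts i j})"

definition TChains :: "nat \<Rightarrow> (int \<times> int) set list set" where
  "TChains n = {ts. tri_chain ts \<and> length ts = n \<and> (\<forall>u\<in>fig_verts ts. deg ts u \<le> 5)}"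

definition ind :: "nat \<Rightarrow> nat \<Rightarrow> real" where
  "ind k l = (if l = k then 1 else 0)"

definition Lam0 :: "(nat \<Rightarrow> nat \<Rightarrow> real) \<Rightarrow> nat \<Rightarrow> real" where
  "Lam0 \<theta> n = 2 * real n * \<theta> 4 4 + 2 * \<theta> 2 3 + 2 * \<theta> 2 4 + 2 * \<theta> 3 4 - \<theta> 3 5 - 4 * \<theta> 4 5"
definition Lam1 :: "(nat \<Rightarrow> nat \<Rightarrow> real) \<Rightarrow> real" where
  "Lam1 \<theta> = \<theta> 2 5 - \<theta> 2 4 + \<theta> 3 3 - 3 * \<theta> 3 4 + \<theta> 3 5 + 3 * \<theta> 4 4 - 2 * \<theta> 4 5"
definition Lam2 :: "(nat \<Rightarrow> nat \<Rightarrow> real) \<Rightarrow> real" where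
  "Lam2 \<theta> = \<theta> 3 5 - \<theta> 3 4 + \<theta> 4 4 - \<theta> 4 5"
definition Lam3 :: "(nat \<Rightarrow> nat \<Rightarrow> real) \<Rightarrow> real" where
  "Lam3 \<theta> = 2 * \<theta> 3 4 + \<theta> 3 5 - 7 * \<theta> 4 4 + 4 * \<theta> 4 5"
definition Lam4 :: "(nat \<Rightarrow> nat \<Rightarrow> real) \<Rightarrow> real" where
  "Lam4 \<theta> = 2 * \<theta> 3 5 - 2 * \<theta> 3 4 + 3 * \<theta> 4 4 - 4 * \<theta> 4 5 + \<theta> 5 5"
definition Lam5 :: "(nat \<Rightarrow> nat \<Rightarrow> real) \<Rightarrow> real" where
  "Lam5 \<theta> = \<theta> 4 4 - 2 * \<theta> 4 5 + \<theta> 5 5"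

end

theory Submission
  imports Defs
begin

text \<open>
  The point of the proof is that a vertex, once left by the chain, never comes back. If it did,
  a closed walk along sides of the chain could be drawn whose winding number is constant on every
  region of the complement, hence 0 because these regions are infinite, and yet jumps by 1 across
  one of its sides; propagating 0 backwards from the last triangle yields a contradiction. The
  winding number around a triangle is computed by counting signed crossings with a horizontal ray.

  Consequently every triangle after the first brings exactly one new vertex, and the degree of a
  vertex is one more than the number of triangles containing it. Since no degree exceeds 5, the
  vertices can be numbered such that the \<open>k\<close>-th triangle is \<open>{v k, v (k+1), v (k+2)}\<close>, except at a
  set \<open>Q\<close> of turning indices, no two consecutive, where \<open>v k\<close> is replaced by \<open>v (k-1)\<close>. Degrees,
  segments and the index are then explicit in terms of \<open>Q\<close>: the segments end at \<open>q - 1\<close> and start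
  at \<open>q - 2\<close> for \<open>q\<close> in \<open>Q\<close>, and every edge weight is a polynomial in the indicator of \<open>Q\<close>.
\<close>

section \<open>Crossing numbers in the triangular lattice\<close>

text \<open>The conditions on shared sides alone would admit a chain that curls around a hole and
  touches itself at a corner. Only the condition on infinite regions excludes this, and it speaks of
  reachability, not of curves; counting crossings replaces a Jordan curve argument by arithmetic in
  the lattice. The constants arise as follows. Without turns the index is
  \<open>Lam0 + Lam3\<close>, that is 2 times \<open>\<theta> 2 3\<close>, 2 times
  \<open>\<theta> 2 4\<close>, 4 times \<open>\<theta> 3 4\<close> and \<open>2n - 7\<close> times
  \<open>\<theta> 4 4\<close>. Each turn adds \<open>Lam3\<close>; two turns at distance 2 or 3
  affect a common edge and add \<open>Lam4\<close> or \<open>Lam5\<close>; a turn at one of the two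
  outermost places at either end adds \<open>Lam1\<close> or \<open>Lam2\<close>. Neighbouring
  segments overlap in two triangles, so a segment between turns \<open>q < q'\<close> has
  \<open>q' - q + 2\<close> triangles. Hence interior lengths 4 and 5 are distances 2 and 3, and
  terminal lengths 3 and 4 are turns at 3 and 4, or at \<open>n - 1\<close> and
  \<open>n - 2\<close>.\<close>

definition up_tri :: "int \<Rightarrow> int \<Rightarrow> (int \<times> int) set" where
  "up_tri a b = {(a,b), (a+1,b), (a,b+1)}"

text \<open>The anchor \<open>(a,b)\<close> is not a vertex here. Both kinds are indexed by their
  coordinatewise minimum, so \<open>up_tri a b\<close> and \<open>down_tri a b\<close> halve the
  same unit parallelogram.\<close>

definition down_tri :: "int \<Rightarrow> int \<Rightarrow> (int \<times> int) set" where
  "down_tri a b = {(a+1,b), (a,b+1), (a+1,b+1)}"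

lemma lattice_tri_iff: "lattice_tri t \<longleftrightarrow> (\<exists>a b. t = up_tri a b \<or> t = down_tri a b)"
proof
  assume L: "lattice_tri t"
  then obtain p q r where t: "t = {p,q,r}" and d: "p \<noteq> q" "p \<noteq> r" "q \<noteq> r"
    unfolding lattice_tri_def card_3_iff by blast
  obtain x y x' y' x'' y'' where pqr: "p = (x,y)" "q = (x',y')" "r = (x'',y'')"
    by (cases p, cases q, cases r)
  have adj: "lat_adj p q" "lat_adj p r" "lat_adj q r"
    using L t d unfolding lattice_tri_def by auto
  \<comment> \<open>The anchor is the minimum of the coordinates, and inclusion suffices as all
    cardinalities are 3. Relative to \<open>p\<close> the other two vertices are among six unit
    vectors, which leaves 36 cases.\<close>
  have "t \<subseteq> up_tri (min (min x x') x'') (min (min y y') y'') \<or>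
        t \<subseteq> down_tri (min (min x x') x'') (min (min y y') y'')"
  proof -
    define i j k l where ijkl: "i = x' - x" "j = y' - y" "k = x'' - x" "l = y'' - y"
    then have e: "x' = x + i" "y' = y + j" "x'' = x + k" "y'' = y + l" by simp_all
    have "(i,j) \<in> {(1,0),(-1,0),(0,1),(0,-1),(1,-1),(-1,1)}"
      "(k,l) \<in> {(1,0),(-1,0),(0,1),(0,-1),(1,-1),(-1,1)}" and
      kl: "(k-i,l-j) \<in> {(1,0),(-1,0),(0,1),(0,-1),(1,-1),(-1,1)}"
      using adj unfolding pqr lat_adj_def e by (simp_all add: algebra_simps)
    then show ?thesis
      unfolding t pqr e up_tri_def down_tri_def
      by (simp only: insert_iff[of "(i,j)"] insert_iff[of "(k,l)"] empty_iff prod.inject)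
         (elim disjE conjE; simp; simp add: min_def)
  qed
  moreover have "card (up_tri a b) = 3" "card (down_tri a b) = 3"
    "finite (up_tri a b)" "finite (down_tri a b)" for a b
    by (simp_all add: up_tri_def down_tri_def)
  moreover have "card t = 3" using L by (simp add: lattice_tri_def)
  ultimately have "t = up_tri (min (min x x') x'') (min (min y y') y'') \<or>
        t = down_tri (min (min x x') x'') (min (min y y') y'')"
    by (metis card_subset_eq)
  then show "\<exists>a b. t = up_tri a b \<or> t = down_tri a b" by blast
next
  assume "\<exists>a b. t = up_tri a b \<or> t = down_tri a b"
  then show "lattice_tri t"
    unfolding lattice_tri_def lat_adj_def up_tri_def down_tri_def
    by (elim exE disjE) (simp_all only:, simp_all)
qed

lemma mem_up_tri: "(x,y) \<in> up_tri a b \<longleftrightarrow> a \<le> x \<and> b \<le> y \<and> x + y \<le> a + b + 1"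
  unfolding up_tri_def by (simp only: insert_iff empty_iff prod.inject) presburger

lemma mem_down_tri: "(x,y) \<in> down_tri a b \<longleftrightarrow> x \<le> a + 1 \<and> y \<le> b + 1 \<and> a + b + 1 \<le> x + y"
  unfolding down_tri_def by (simp only: insert_iff empty_iff prod.inject) presburger

definition across :: "(int \<times> int) set \<Rightarrow> (int \<times> int) set \<Rightarrow> int \<times> int \<Rightarrow> int \<times> int \<Rightarrow> bool" where
  "across u d p q \<longleftrightarrow> (\<exists>a b. u = up_tri a b \<and>
     (d = down_tri a b \<and> {p,q} = {(a+1,b),(a,b+1)} \<or>
      d = down_tri (a-1) b \<and> {p,q} = {(a,b),(a,b+1)} \<or>
      d = down_tri a (b-1) \<and> {p,q} = {(a,b),(a+1,b)}))"

lemma up_tri_neq_down_tri: "up_tri x y \<noteq> down_tri a b"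
proof
  assume "up_tri x y = down_tri a b"
  moreover have "(x,y) \<in> up_tri x y" "(x+1,y) \<in> up_tri x y" "(x,y+1) \<in> up_tri x y"
    by (simp_all add: up_tri_def)
  ultimately show False by (simp add: mem_down_tri)
qed

text \<open>With its downward twin this puts at most one triangle of each orientation on a side, so
  passing through a side always flips the orientation.\<close>

lemma up_up_eq: "p \<noteq> q \<Longrightarrow> {p,q} \<subseteq> up_tri a b \<Longrightarrow> {p,q} \<subseteq> up_tri a' b' \<Longrightarrow> a = a' \<and> b = b'"
  by (cases p, cases q, simp add: mem_up_tri) smt

lemma down_down_eq: "p \<noteq> q \<Longrightarrow> {p,q} \<subseteq> down_tri a b \<Longrightarrow> {p,q} \<subseteq> down_tri a' b' \<Longrightarrow> a = a' \<and> b = b'"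
  by (cases p, cases q, simp add: mem_down_tri) smt

lemma up_down_across:
  assumes "p \<noteq> q" "{p,q} \<subseteq> up_tri a b" "{p,q} \<subseteq> down_tri a' b'"
  shows "across (up_tri a b) (down_tri a' b') p q"
proof -
  obtain x y x' y' where pq: "p = (x,y)" "q = (x',y')" by (cases p, cases q)
  have m: "a \<le> x" "b \<le> y" "x + y \<le> a + b + 1" "a \<le> x'" "b \<le> y'" "x' + y' \<le> a + b + 1"
    "x \<le> a' + 1" "y \<le> b' + 1" "a' + b' + 1 \<le> x + y"
    "x' \<le> a' + 1" "y' \<le> b' + 1" "a' + b' + 1 \<le> x' + y'"
    using assms(2,3) by (simp_all add: pq mem_up_tri mem_down_tri)
  have d: "x \<noteq> x' \<or> y \<noteq> y'" using assms(1) pq by simp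
  consider "a' = a" "b' = b" | "a' = a - 1" "b' = b" | "a' = a" "b' = b - 1"
    using m d by smt
  then show ?thesis
  proof cases
    case 1
    then have "x = a + 1 \<and> y = b \<and> x' = a \<and> y' = b + 1 \<or> x = a \<and> y = b + 1 \<and> x' = a + 1 \<and> y' = b"
      using m d by smt
    then show ?thesis unfolding across_def 1 pq by blast
  next
    case 2
    then have "x = a \<and> y = b \<and> x' = a \<and> y' = b + 1 \<or> x = a \<and> y = b + 1 \<and> x' = a \<and> y' = b"
      using m d by smt
    then show ?thesis unfolding across_def 2 pq by blast
  next
    case 3
    then have "x = a \<and> y = b \<and> x' = a + 1 \<and> y' = b \<or> x = a + 1 \<and> y = b \<and> x' = a \<and> y' = b"
      using m d by smt
    then show ?thesis unfolding across_def 3 pq by blast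
  qed
qed

lemma across_if_common_side:
  assumes "lattice_tri t" "lattice_tri t'" "t \<noteq> t'" "p \<noteq> q" "{p,q} \<subseteq> t" "{p,q} \<subseteq> t'"
  shows "across t t' p q \<or> across t' t p q"
  using assms unfolding lattice_tri_iff
  by (metis up_up_eq down_down_eq up_down_across)

lemma common_side_unique:
  assumes "lattice_tri t" "lattice_tri t'" "lattice_tri t''" "p \<noteq> q"
    "{p,q} \<subseteq> t" "{p,q} \<subseteq> t'" "{p,q} \<subseteq> t''" "t \<noteq> t'" "t \<noteq> t''"
  shows "t' = t''"
  using assms unfolding lattice_tri_iff by (metis up_up_eq down_down_eq)

lemma other_tri_exists:
  assumes "lattice_tri t" "p \<noteq> q" "{p,q} \<subseteq> t"
  shows "\<exists>t'. lattice_tri t' \<and> t' \<noteq> t \<and> {p,q} \<subseteq> t'"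
proof -
  obtain a b where "t = up_tri a b \<or> t = down_tri a b" using assms(1) lattice_tri_iff by blast
  then show ?thesis
  proof
    assume t: "t = up_tri a b"
    have "{p,q} \<subseteq> down_tri a b \<or> {p,q} \<subseteq> down_tri (a-1) b \<or> {p,q} \<subseteq> down_tri a (b-1)"
      using assms(2,3) unfolding t up_tri_def down_tri_def by auto
    then show ?thesis using lattice_tri_iff up_tri_neq_down_tri t by metis
  next
    assume t: "t = down_tri a b"
    have "{p,q} \<subseteq> up_tri a b \<or> {p,q} \<subseteq> up_tri (a+1) b \<or> {p,q} \<subseteq> up_tri a (b+1)"
      using assms(2,3) unfolding t up_tri_def down_tri_def by auto
    then show ?thesis using lattice_tri_iff up_tri_neq_down_tri t by metis
  qed
qed

text \<open>The signed number of crossings of the step from \<open>p\<close> to \<open>q\<close> with the horizontal ray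
  that starts in the triangle \<open>t\<close> and points to the right.\<close>

definition crossing :: "(int \<times> int) set \<Rightarrow> int \<times> int \<Rightarrow> int \<times> int \<Rightarrow> int" where
  "crossing t p q = (let a = Min (fst ` t); b = Min (snd ` t) in
     if snd p = b \<and> snd q = b + 1 \<and> a < fst (if (a,b) \<in> t then p else q) then 1
     else if snd q = b \<and> snd p = b + 1 \<and> a < fst (if (a,b) \<in> t then q else p) then - 1
     else 0)"

text \<open>The ray starts at the centroid, at one third of the row's height in an up triangle and
  at two thirds in a down triangle. Whether a side between the two rows passes to the right of it is
  decided by the endpoint in the nearer row: the lower one here, the upper one in
  \<open>crossing_down\<close>.\<close>

lemma crossing_up: "crossing (up_tri a b) p q =
    (if snd p = b \<and> snd q = b + 1 \<and> a < fst p then 1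
     else if snd q = b \<and> snd p = b + 1 \<and> a < fst q then - 1 else 0)"
proof -
  have "Min (fst ` up_tri a b) = a" "Min (snd ` up_tri a b) = b" "(a,b) \<in> up_tri a b"
    by (auto simp: up_tri_def)
  then show ?thesis by (simp add: crossing_def Let_def)
qed

lemma crossing_down: "crossing (down_tri a b) p q =
    (if snd p = b \<and> snd q = b + 1 \<and> a < fst q then 1
     else if snd q = b \<and> snd p = b + 1 \<and> a < fst p then - 1 else 0)"
proof -
  have "Min (fst ` down_tri a b) = a" "Min (snd ` down_tri a b) = b" "(a,b) \<notin> down_tri a b"
    by (auto simp: down_tri_def)
  then show ?thesis by (simp add: crossing_def Let_def)
qed

text \<open>The jump of the winding number in discrete form: moving the start of the ray through the
  side \<open>{p,q}\<close> changes every count by a potential difference, which telescopes along a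
  walk, except for an extra \<open>c\<close> when the walk uses that side.\<close>

lemma crossing_across_up_down:
  assumes "across u d p q"
  obtains \<phi> :: "int \<times> int \<Rightarrow> int" and c :: int where "c = 1 \<or> c = -1"
    "\<And>x y. lat_adj x y \<Longrightarrow> {x,y} \<noteq> {p,q} \<Longrightarrow> crossing u x y - crossing d x y = \<phi> x - \<phi> y"
    "crossing u p q - crossing d p q = \<phi> p - \<phi> q + c"
proof -
  obtain a b where u: "u = up_tri a b" and
    "d = down_tri a b \<and> {p,q} = {(a+1,b),(a,b+1)} \<or>
      d = down_tri (a-1) b \<and> {p,q} = {(a,b),(a,b+1)} \<or>
      d = down_tri a (b-1) \<and> {p,q} = {(a,b),(a+1,b)}"
    using assms unfolding across_def by blast
  then consider "d = down_tri a b" "{p,q} = {(a+1,b),(a,b+1)}"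
    | "d = down_tri (a-1) b" "{p,q} = {(a,b),(a,b+1)}"
    | "d = down_tri a (b-1)" "{p,q} = {(a,b),(a+1,b)}" by blast
  then show thesis
  proof cases
    \<comment> \<open>Both rays lie in the same row and only the common side separates their
      starting points, so \<open>\<phi>\<close> is 0; likewise in the next case.\<close>
    case 1
    show thesis
    proof (rule that[of "crossing u p q - crossing d p q" "\<lambda>_. 0"])
      show "crossing u x y - crossing d x y = 0 - 0" if "lat_adj x y" "{x,y} \<noteq> {p,q}" for x y
      proof -
        obtain i j i' j' where xy: "x = (i,j)" "y = (i',j')" by (cases x, cases y)
        have "(i,j) = (a+1,b) \<longrightarrow> (i',j') \<noteq> (a,b+1)" "(i,j) = (a,b+1) \<longrightarrow> (i',j') \<noteq> (a+1,b)"
          using that(2) unfolding 1 xy by (auto simp: doubleton_eq_iff)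
        then show ?thesis using that(1) unfolding u 1 lat_adj_def xy crossing_up crossing_down
          by (simp only: fst_conv snd_conv insert_iff empty_iff prod.inject) smt
      qed
      show "crossing u p q - crossing d p q = 1 \<or> crossing u p q - crossing d p q = - 1"
        using 1(2) unfolding u 1(1) doubleton_eq_iff by (auto simp: crossing_up crossing_down)
    qed simp
  next
    case 2
    show thesis
    proof (rule that[of "crossing u p q - crossing d p q" "\<lambda>_. 0"])
      show "crossing u x y - crossing d x y = 0 - 0" if "lat_adj x y" "{x,y} \<noteq> {p,q}" for x y
      proof -
        obtain i j i' j' where xy: "x = (i,j)" "y = (i',j')" by (cases x, cases y)
        have "(i,j) = (a,b) \<longrightarrow> (i',j') \<noteq> (a,b+1)" "(i,j) = (a,b+1) \<longrightarrow> (i',j') \<noteq> (a,b)"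
          using that(2) unfolding 2 xy by (auto simp: doubleton_eq_iff)
        then show ?thesis using that(1) unfolding u 2 lat_adj_def xy crossing_up crossing_down
          by (simp only: fst_conv snd_conv insert_iff empty_iff prod.inject) smt
      qed
      show "crossing u p q - crossing d p q = 1 \<or> crossing u p q - crossing d p q = - 1"
        using 2(2) unfolding u 2(1) doubleton_eq_iff by (auto simp: crossing_up crossing_down)
    qed simp
  next
    case 3
    \<comment> \<open>Now the rays lie in neighbouring rows. \<open>\<phi>\<close> marks the
      vertices on the line between them to the right of \<open>a\<close>: crossing one of the rays
      means entering or leaving this set, and along the line itself that happens only through the
      common side.\<close>
    define \<phi> :: "int \<times> int \<Rightarrow> int" where "\<phi> = (\<lambda>x. if snd x = b \<and> a < fst x then 1 else 0)"
    show thesis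
    proof (rule that[of "crossing u p q - crossing d p q - \<phi> p + \<phi> q" \<phi>])
      show "crossing u x y - crossing d x y = \<phi> x - \<phi> y" if "lat_adj x y" "{x,y} \<noteq> {p,q}" for x y
      proof -
        obtain i j i' j' where xy: "x = (i,j)" "y = (i',j')" by (cases x, cases y)
        have "(i,j) = (a,b) \<longrightarrow> (i',j') \<noteq> (a+1,b)" "(i,j) = (a+1,b) \<longrightarrow> (i',j') \<noteq> (a,b)"
          using that(2) unfolding 3 xy by (auto simp: doubleton_eq_iff)
        then show ?thesis using that(1) unfolding u 3 lat_adj_def xy \<phi>_def crossing_up crossing_down
          by (simp only: fst_conv snd_conv insert_iff empty_iff prod.inject) smt
      qed
      show "crossing u p q - crossing d p q - \<phi> p + \<phi> q = 1 \<or>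
            crossing u p q - crossing d p q - \<phi> p + \<phi> q = - 1"
        using 3(2) unfolding u 3(1) doubleton_eq_iff
        by (auto simp: crossing_up crossing_down \<phi>_def)
    qed simp
  qed
qed

lemma crossing_common_side:
  assumes "lattice_tri t" "lattice_tri t'" "t \<noteq> t'" "p \<noteq> q" "{p,q} \<subseteq> t" "{p,q} \<subseteq> t'"
  obtains \<phi> :: "int \<times> int \<Rightarrow> int" and c :: int where "c = 1 \<or> c = -1"
    "\<And>x y. lat_adj x y \<Longrightarrow> {x,y} \<noteq> {p,q} \<Longrightarrow> crossing t x y - crossing t' x y = \<phi> x - \<phi> y"
    "crossing t p q - crossing t' p q = \<phi> p - \<phi> q + c"
  using across_if_common_side[OF assms]
proof
  assume "across t t' p q"
  then show thesis using crossing_across_up_down that by metis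
next
  assume "across t' t p q"
  then obtain \<phi> :: "int \<times> int \<Rightarrow> int" and c :: int where "c = 1 \<or> c = -1"
    "\<And>x y. lat_adj x y \<Longrightarrow> {x,y} \<noteq> {p,q} \<Longrightarrow> crossing t' x y - crossing t x y = \<phi> x - \<phi> y"
    "crossing t' p q - crossing t p q = \<phi> p - \<phi> q + c"
    by (rule crossing_across_up_down) blast
  then show thesis
    by (intro that[of "-c" "\<lambda>x. - \<phi> x"]) (fastforce | smt (verit))+
qed

text \<open>\<open>f t\<close> is the total weight \<open>w t\<close> of some walk from \<open>p\<close> to \<open>q\<close>, the same walk for all \<open>t\<close>.\<close>

inductive walk_sum :: "('a \<Rightarrow> 'a \<Rightarrow> bool) \<Rightarrow> ('t \<Rightarrow> 'a \<Rightarrow> 'a \<Rightarrow> int) \<Rightarrow> 'a \<Rightarrow> 'a \<Rightarrow> ('t \<Rightarrow> int) \<Rightarrow> bool"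
  for R w where
  walk_sum_refl: "walk_sum R w p p (\<lambda>t. 0)"
| walk_sum_step: "R p q \<Longrightarrow> walk_sum R w q r f \<Longrightarrow> walk_sum R w p r (\<lambda>t. w t p q + f t)"

lemma walk_sum_exists: "R\<^sup>*\<^sup>* p q \<Longrightarrow> \<exists>f. walk_sum R w p q f"
  by (induction rule: converse_rtranclp_induct) (blast intro: walk_sum.intros)+

lemma walk_sum_telescope:
  assumes "walk_sum R w p q f" "\<And>x y. R x y \<Longrightarrow> w t x y = \<phi> x - \<phi> y"
  shows "f t = \<phi> p - \<phi> q"
  using assms by (induction rule: walk_sum.induct) auto

lemma walk_sum_diff_telescope:
  assumes "walk_sum R w p q f" "\<And>x y. R x y \<Longrightarrow> w t x y - w t' x y = \<phi> x - \<phi> y"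
  shows "f t - f t' = \<phi> p - \<phi> q"
  using assms by (induction rule: walk_sum.induct) (auto, smt (verit))

text \<open>Far to the left of a bounded walk the ray sees every crossing of its row, and these cancel.\<close>

lemma finite_nonzero_closed_walk:
  assumes R: "\<And>x y. R x y \<Longrightarrow> x \<in> V \<and> y \<in> V \<and> lat_adj x y" and V: "finite V"
    and f: "walk_sum R crossing p p f"
  shows "finite {t. lattice_tri t \<and> f t \<noteq> 0}"
proof -
  define M where "M = 1 + Max (insert 0 (abs ` (fst ` V \<union> snd ` V)))"
  have "\<bar>z\<bar> < M" if "z \<in> fst ` V \<union> snd ` V" for z
  proof -
    have "\<bar>z\<bar> \<le> Max (insert 0 (abs ` (fst ` V \<union> snd ` V)))"
      using V that by (intro Max_ge) auto
    then show ?thesis unfolding M_def by simp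
  qed
  then have Mb: "\<bar>fst z\<bar> < M" "\<bar>snd z\<bar> < M" if "z \<in> V" for z using that by auto
  have zero: "f t = 0" if t: "t = up_tri a b \<or> t = down_tri a b" and ab: "M < \<bar>a\<bar> \<or> M < \<bar>b\<bar>" for t a b
  \<comment> \<open>In the first case the ray misses the walk, as its row is outside the range of
    \<open>V\<close> or it starts to the right of \<open>V\<close>.\<close>
  proof (cases "M < \<bar>b\<bar> \<or> M < a")
    case True
    have "crossing t x y = 0 - 0" if "R x y" for x y
      using R[OF that] Mb[of x] Mb[of y] t True by (auto simp: crossing_up crossing_down)
    then show ?thesis using walk_sum_telescope[OF f, of t "\<lambda>_. 0"] by simp
  next
    case False
    then have a: "a < - M" using ab by linarith
    have "crossing t x y = (if snd x \<le> b then 1 else 0) - (if snd y \<le> b then 1 else 0)" if "R x y" for x y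
      using R[OF that] Mb[of x] Mb[of y] t a by (auto simp: crossing_up crossing_down lat_adj_def)
    then show ?thesis using walk_sum_telescope[OF f, of t "\<lambda>x. if snd x \<le> b then 1 else 0"] by simp
  qed
  have "{t. lattice_tri t \<and> f t \<noteq> 0} \<subseteq>
      case_prod up_tri ` ({-M..M} \<times> {-M..M}) \<union> case_prod down_tri ` ({-M..M} \<times> {-M..M})"
  proof
    fix t assume t: "t \<in> {t. lattice_tri t \<and> f t \<noteq> 0}"
    then obtain a b where ab: "t = up_tri a b \<or> t = down_tri a b" using lattice_tri_iff by blast
    then have "\<not> (M < \<bar>a\<bar> \<or> M < \<bar>b\<bar>)" using zero[OF ab] t by auto
    then have "a \<in> {-M..M}" "b \<in> {-M..M}" by auto
    then show "t \<in> case_prod up_tri ` ({-M..M} \<times> {-M..M}) \<union> case_prod down_tri ` ({-M..M} \<times> {-M..M})"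
      using ab by (force simp: image_iff)
  qed
  then show ?thesis by (rule finite_subset) simp
qed

section \<open>Vertices of a chain do not recur\<close>

lemma walk_sum_mono: "walk_sum R w p q f \<Longrightarrow> (\<And>x y. R x y \<Longrightarrow> R' x y) \<Longrightarrow> walk_sum R' w p q f"
  by (induction rule: walk_sum.induct) (auto intro: walk_sum.intros)

lemma tri_chain_lattice: "tri_chain ts \<Longrightarrow> i < length ts \<Longrightarrow> lattice_tri (ts ! i)"
  by (simp add: tri_chain_def)

lemma lattice_tri_card: "lattice_tri t \<Longrightarrow> card t = 3 \<and> finite t"
  by (metis lattice_tri_def card.infinite zero_neq_numeral)

lemma shares_side_if_common_side:
  assumes "lattice_tri t" "lattice_tri t'" "t \<noteq> t'" "p \<noteq> q" "{p,q} \<subseteq> t" "{p,q} \<subseteq> t'"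
  shows "shares_side t t'"
proof -
  have f: "finite t" "finite t'" "card t = 3" "card t' = 3" using assms(1,2) lattice_tri_card by auto
  have "card {p,q} \<le> card (t \<inter> t')" using assms f by (intro card_mono) auto
  moreover have "card (t \<inter> t') \<noteq> 3"
    using f assms(3) by (metis Int_lower1 Int_lower2 card_subset_eq)
  moreover have "card (t \<inter> t') \<le> 3" using f by (metis Int_lower1 card_mono)
  ultimately show ?thesis using assms(4) by (simp add: shares_side_def)
qed

lemma tri_chain_side_consecutive:
  assumes "tri_chain ts" "i < j" "j < length ts" "p \<noteq> q" "{p,q} \<subseteq> ts ! i" "{p,q} \<subseteq> ts ! j"
  shows "j = Suc i"
proof -
  have "ts ! i \<noteq> ts ! j" using assms by (metis nth_eq_iff_index_eq tri_chain_def order.strict_trans less_irrefl)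
  then have "shares_side (ts ! i) (ts ! j)"
    using shares_side_if_common_side[of "ts ! i" "ts ! j" p q] assms tri_chain_lattice by auto
  then show ?thesis using assms unfolding tri_chain_def by blast
qed

lemma tri_chain_Int:
  assumes "tri_chain ts" "Suc k < length ts"
  obtains a b where "a \<noteq> b" "ts ! k \<inter> ts ! Suc k = {a,b}"
proof -
  have "card (ts ! k \<inter> ts ! Suc k) = 2"
    using assms unfolding tri_chain_def shares_side_def by auto
  then show thesis using that by (auto simp: card_2_iff)
qed

lemma card3_third:
  assumes "card t = 3" "a \<noteq> b" "a \<in> t" "b \<in> t"
  obtains c where "t = {a,b,c}" "c \<noteq> a" "c \<noteq> b"
  using assms that unfolding card_3_iff by (smt (verit) insert_commute insert_iff singletonD)

lemma shares_side_commute: "shares_side t t' \<longleftrightarrow> shares_side t' t"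
  by (simp add: shares_side_def Int_commute)

text \<open>An end triangle shares just one side with the chain; the lattice triangle across another
  of its sides is therefore missing. This is the exit from the chain into the complement.\<close>

lemma end_tri_has_missing_neighbour:
  assumes ch: "tri_chain ts" and e: "e < length ts" "e' < length ts" "shares_side (ts ! e') (ts ! e)"
    and only: "\<And>j. j < length ts \<Longrightarrow> shares_side (ts ! j) (ts ! e) \<Longrightarrow> j = e'"
  obtains p r t where "p \<noteq> r" "{p,r} \<subseteq> ts ! e" "\<not> {p,r} \<subseteq> ts ! e'"
    "lattice_tri t" "t \<notin> set ts" "{p,r} \<subseteq> t"
proof -
  obtain p q where pq: "p \<noteq> q" "ts ! e' \<inter> ts ! e = {p,q}"
    using e(3) unfolding shares_side_def card_2_iff by blast
  have L: "lattice_tri (ts ! e)" using ch e tri_chain_lattice by simp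
  obtain r where r: "ts ! e = {p,q,r}" "r \<noteq> p" "r \<noteq> q"
    using card3_third[of "ts ! e" p q] lattice_tri_card[OF L] pq by blast
  have rk: "r \<notin> ts ! e'" using pq r by auto
  obtain t where t: "lattice_tri t" "t \<noteq> ts ! e" "{p,r} \<subseteq> t"
    using other_tri_exists[OF L, of p r] r by auto
  have "shares_side t (ts ! e)"
    using shares_side_if_common_side[of t "ts ! e" p r] t r L by auto
  then have "t \<notin> set ts" using only rk t by (metis in_set_conv_nth insert_subset)
  then show thesis using that[of p r t] r t rk by auto
qed

lemma tri_chain_ends_missing:
  assumes ch: "tri_chain ts" and n: "2 \<le> length ts" and e: "e = 0 \<and> e' = 1 \<or> Suc e = length ts \<and> e = Suc e'"
  obtains p r t where "p \<noteq> r" "{p,r} \<subseteq> ts ! e" "\<not> {p,r} \<subseteq> ts ! e'"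
    "lattice_tri t" "t \<notin> set ts" "{p,r} \<subseteq> t"
proof -
  have iff: "shares_side (ts ! i) (ts ! j) \<longleftrightarrow> j = Suc i" if "i < j" "j < length ts" for i j
    using ch that unfolding tri_chain_def by blast
  have irr: "\<not> shares_side (ts ! i) (ts ! i)" if "i < length ts" for i
    using lattice_tri_card[OF tri_chain_lattice[OF ch that]] by (simp add: shares_side_def)
  show thesis
  proof (rule end_tri_has_missing_neighbour[OF ch])
    show "e < length ts" "e' < length ts" using e n by auto
    show "shares_side (ts ! e') (ts ! e)"
      using e n iff[of 0 1] iff[of e' e] by (auto simp: shares_side_commute)
    show "j = e'" if "j < length ts" "shares_side (ts ! j) (ts ! e)" for j
      using e
    proof
      assume "e = 0 \<and> e' = 1"
      then show ?thesis using that iff[of 0 j] irr[of 0] by (cases "j = 0") (auto simp: shares_side_commute)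
    next
      assume "Suc e = length ts \<and> e = Suc e'"
      then show ?thesis using that iff[of j e] irr[of e] by (cases "j = e") auto
    qed
  qed (rule that)
qed

text \<open>If a vertex \<open>z\<close> came back after having been left, a walk in the figure would run from
  \<open>ts ! k\<close> back to \<open>z\<close> through earlier triangles. Closed up by a single side at \<open>z\<close> of
  \<open>ts ! Suc k\<close>, it winds by 0 around all triangles outside the first part of the chain, but by a
  different amount on the two sides of that closing side.\<close>

lemma tri_chain_no_return:
  assumes ch: "tri_chain ts" and k: "Suc k < length ts" and ik: "i \<le> k"
    and zi: "z \<in> ts ! i" and zk: "z \<in> ts ! Suc k"
  shows "z \<in> ts ! k"
proof (rule ccontr)
  assume nz: "z \<notin> ts ! k"
  note L = tri_chain_lattice[OF ch]
  have dist: "ts ! x \<noteq> ts ! y" if "x < length ts" "y < length ts" "x \<noteq> y" for x y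
    using ch that by (simp add: tri_chain_def nth_eq_iff_index_eq)
  obtain a b where ab: "a \<noteq> b" "ts ! k \<inter> ts ! Suc k = {a,b}"
    using tri_chain_Int[OF ch k] .
  have za: "z \<noteq> a" "z \<noteq> b" using nz ab by auto
  obtain c where c: "ts ! Suc k = {a,b,c}"
    using card3_third[of "ts ! Suc k" a b] lattice_tri_card[OF L[OF k]] ab by blast
  have tm: "ts ! Suc k = {a,b,z}" using c zk za by auto
  define R where "R = (\<lambda>p q. \<exists>l\<le>k. p \<in> ts ! l \<and> q \<in> ts ! l \<and> p \<noteq> q)"
  have "R\<^sup>*\<^sup>* x z" if "i + d \<le> k" "x \<in> ts ! (i + d)" for d x
    using that
  proof (induction d arbitrary: x)
    case 0
    then show ?case using zi ik unfolding R_def by (cases "x = z") auto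
  next
    case (Suc d)
    then have "Suc (i + d) < length ts" using k by simp
    then obtain y y' where y: "ts ! (i + d) \<inter> ts ! Suc (i + d) = {y,y'}"
      using tri_chain_Int[OF ch] by metis
    then have "y \<in> ts ! (i + d)" by blast
    then have "R\<^sup>*\<^sup>* y z" using Suc.IH Suc.prems by simp
    moreover have "x = y \<or> R x y" using Suc.prems y unfolding R_def by auto
    ultimately show ?case by (auto intro: converse_rtranclp_into_rtranclp)
  qed
  from this[of "k - i" a] have "R\<^sup>*\<^sup>* a z" using ik ab by auto
  then obtain f where f: "walk_sum R crossing a z f" using walk_sum_exists by metis
  \<comment> \<open>\<open>R'\<close> adds the closing side, which \<open>F\<close> uses exactly
    once: no step of \<open>R\<close> runs along it (see \<open>no_za\<close>).\<close>
  define R' where "R' = (\<lambda>p q. R p q \<or> p = z \<and> q = a)"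
  define F where "F = (\<lambda>t. crossing t z a + f t)"
  have F: "walk_sum R' crossing z z F"
    unfolding F_def by (rule walk_sum_step) (auto simp: R'_def intro: walk_sum_mono[OF f])
  have R'_tri: "\<exists>l\<le>Suc k. {x,y} \<subseteq> ts ! l" "x \<noteq> y" if "R' x y" for x y
    using that za tm unfolding R'_def R_def by (auto intro: le_SucI)
  have R'_adj: "lat_adj x y" if "R' x y" for x y
    using R'_tri[OF that] L k unfolding lattice_tri_def by (metis insert_subset le_less_trans)
  have fin: "finite {t. lattice_tri t \<and> F t \<noteq> 0}"
  proof (rule finite_nonzero_closed_walk[OF _ _ F, of "\<Union>(set ts)"])
    show "x \<in> \<Union>(set ts) \<and> y \<in> \<Union>(set ts) \<and> lat_adj x y" if "R' x y" for x y
      using R'_tri[OF that] R'_adj[OF that] k by (meson UnionI insert_subset le_less_trans nth_mem)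
    show "finite (\<Union>(set ts))"
      using ch lattice_tri_card by (auto simp: tri_chain_def)
  qed
  \<comment> \<open>Across a side that the walk does not use, the count changes by a potential
    difference, and this vanishes on a closed walk.\<close>
  have const: "F t = F t'" if h: "lattice_tri t" "lattice_tri t'" "t \<noteq> t'" "p \<noteq> q" "{p,q} \<subseteq> t" "{p,q} \<subseteq> t'"
    and no: "\<And>l. l \<le> k \<Longrightarrow> \<not> {p,q} \<subseteq> ts ! l" and pza: "{p,q} \<noteq> {z,a}" for t t' p q
  proof -
    obtain \<phi> :: "int \<times> int \<Rightarrow> int" where
      \<phi>: "\<And>x y. lat_adj x y \<Longrightarrow> {x,y} \<noteq> {p,q} \<Longrightarrow> crossing t x y - crossing t' x y = \<phi> x - \<phi> y"
      using crossing_common_side[OF h] by metis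
    have "{x,y} \<noteq> {p,q}" if "R' x y" for x y
    proof -
      have "R x y \<or> {x,y} = {z,a}" using that unfolding R'_def by auto
      then show ?thesis using pza no unfolding R_def by (metis empty_subsetI insert_subset)
    qed
    then have "F t - F t' = \<phi> z - \<phi> z"
      by (intro walk_sum_diff_telescope[OF F]) (use \<phi> R'_adj in blast)
    then show ?thesis by simp
  qed
  \<comment> \<open>An earlier triangle sharing a side with \<open>ts ! Suc k\<close> must be
    \<open>ts ! k\<close>, which does not contain \<open>z\<close>.\<close>
  have no_za: "\<not> {z,a} \<subseteq> ts ! l" "\<not> {b,z} \<subseteq> ts ! l" if "l \<le> k" for l
    using tri_chain_side_consecutive[OF ch, of l "Suc k" z a] tri_chain_side_consecutive[OF ch, of l "Suc k" b z]
      that k za tm nz by auto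
  have jump: "F t \<noteq> F t'" if h: "lattice_tri t" "lattice_tri t'" "t \<noteq> t'" "{z,a} \<subseteq> t" "{z,a} \<subseteq> t'" for t t'
  proof -
    obtain \<phi> :: "int \<times> int \<Rightarrow> int" and c :: int where c: "c = 1 \<or> c = -1" and
      \<phi>: "\<And>x y. lat_adj x y \<Longrightarrow> {x,y} \<noteq> {z,a} \<Longrightarrow> crossing t x y - crossing t' x y = \<phi> x - \<phi> y"
      and \<phi>c: "crossing t z a - crossing t' z a = \<phi> z - \<phi> a + c"
      by (rule crossing_common_side[OF h(1-3) za(1) h(4,5)]) (rule that; assumption)
    have "{x,y} \<noteq> {z,a}" "lat_adj x y" if "R x y" for x y
      using no_za that R'_adj unfolding R_def R'_def by (metis empty_subsetI insert_subset)+
    then have "f t - f t' = \<phi> a - \<phi> z"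
      by (intro walk_sum_diff_telescope[OF f]) (use \<phi> in blast)
    then show ?thesis using \<phi>c c unfolding F_def by auto
  qed
  have missing: "F t = 0" if t: "lattice_tri t" "t \<notin> set ts" for t
  proof (rule ccontr)
    assume "F t \<noteq> 0"
    have step: "F x = F y" if xy: "(x,y) \<in> missing_adj ts" for x y
    proof -
      have x: "lattice_tri x" "lattice_tri y" "x \<notin> set ts" "y \<notin> set ts" "card (x \<inter> y) = 2"
        using xy by (auto simp: missing_adj_def shares_side_def)
      then obtain p q where pq: "x \<inter> y = {p,q}" "p \<noteq> q" by (auto simp: card_2_iff)
      have xy': "x \<noteq> y" using x lattice_tri_card by auto
      \<comment> \<open>\<open>x\<close> and \<open>y\<close> are the only lattice triangles on
        \<open>{p,q}\<close>, and both are missing.\<close>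
      have no: "\<not> {p,q} \<subseteq> ts ! l" if "l \<le> Suc k" for l
      proof
        assume pl: "{p,q} \<subseteq> ts ! l"
        have l: "l < length ts" using that k by simp
        have "{p,q} \<subseteq> x" "{p,q} \<subseteq> y" using pq(1) by blast+
        moreover have "x \<noteq> ts ! l" using x(3) nth_mem[OF l] by metis
        ultimately have "y = ts ! l" using common_side_unique[OF x(1,2) L[OF l] pq(2) _ _ pl xy'] by simp
        then show False using x(4) nth_mem[OF l] by metis
      qed
      then have "{p,q} \<noteq> {z,a}" using tm by (metis empty_subsetI insertCI insert_subset order_refl)
      then show ?thesis using no x pq xy' by (intro const[of x y p q]) auto
    qed
    have comp: "lattice_tri t' \<and> F t' = F t" if "(t,t') \<in> (missing_adj ts)\<^sup>*" for t'
      using that by induction (use t step in \<open>auto simp: missing_adj_def\<close>)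
    have "{t'. (t,t') \<in> (missing_adj ts)\<^sup>*} \<subseteq> {t. lattice_tri t \<and> F t \<noteq> 0}"
    proof
      fix t' assume "t' \<in> {t'. (t,t') \<in> (missing_adj ts)\<^sup>*}"
      then have "lattice_tri t' \<and> F t' = F t" by (intro comp) simp
      then show "t' \<in> {t. lattice_tri t \<and> F t \<noteq> 0}" using \<open>F t \<noteq> 0\<close> by simp
    qed
    then have "finite {t'. (t,t') \<in> (missing_adj ts)\<^sup>*}" using fin finite_subset by blast
    then show False using ch t unfolding tri_chain_def by blast
  qed
  have later: "F (ts ! j) = 0" if "Suc k < j" "j < length ts" for j
    using that
  proof (induction "length ts - j" arbitrary: j)
    case 0
    then show ?case by simp
  next
    case (Suc d)
    have no: "\<not> {p,q} \<subseteq> ts ! l" if "{p,q} \<subseteq> ts ! j" "p \<noteq> q" "l \<le> k" for p q l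
      using tri_chain_side_consecutive[OF ch, of l j p q] that Suc.prems by auto
    show ?case
    proof (cases "Suc j = length ts")
      case True
      then obtain j' where j': "j = Suc j'" using Suc.prems by (cases j) auto
      obtain p r t where t: "p \<noteq> r" "{p,r} \<subseteq> ts ! j" "\<not> {p,r} \<subseteq> ts ! j'"
        "lattice_tri t" "t \<notin> set ts" "{p,r} \<subseteq> t"
      proof -
        have e: "2 \<le> length ts" "j = 0 \<and> j' = 1 \<or> Suc j = length ts \<and> j = Suc j'"
          using True j' Suc.prems by auto
        show thesis by (rule tri_chain_ends_missing[OF ch e]) (rule that; assumption)
      qed
      \<comment> \<open>Otherwise the side lies in \<open>ts ! Suc k\<close>, which must then be the
        predecessor \<open>ts ! j'\<close>; but \<open>{p,r}\<close> was chosen not to lie in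
        \<open>ts ! j'\<close>.\<close>
      have "{p,r} \<noteq> {z,a}"
      proof
        assume "{p,r} = {z,a}"
        then have "{p,r} \<subseteq> ts ! Suc k" using tm by simp
        then have "j = Suc (Suc k)"
          using tri_chain_side_consecutive[OF ch, of "Suc k" j p r] t Suc.prems by auto
        then show False using \<open>{p,r} \<subseteq> ts ! Suc k\<close> t j' by auto
      qed
      moreover have "ts ! j \<noteq> t" using t Suc.prems nth_mem by metis
      ultimately have "F (ts ! j) = F t"
        using const[OF L[OF Suc.prems(2)] t(4) _ t(1,2,6) no[OF t(2,1)]] by blast
      then show ?thesis using missing t by simp
    next
      case False
      then have j: "Suc j < length ts" using Suc.prems by simp
      obtain p q where pq: "p \<noteq> q" "ts ! j \<inter> ts ! Suc j = {p,q}"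
        using tri_chain_Int[OF ch j] .
      have "{p,q} \<noteq> {z,a}"
      proof
        assume "{p,q} = {z,a}"
        then have "{p,q} \<subseteq> ts ! Suc k" using tm by simp
        then show False
          using tri_chain_side_consecutive[OF ch, of "Suc k" "Suc j" p q] pq Suc.prems j by auto
      qed
      have "F (ts ! j) = F (ts ! Suc j)"
      proof -
        have sub: "{p,q} \<subseteq> ts ! j" "{p,q} \<subseteq> ts ! Suc j" using pq(2) by blast+
        have "ts ! j \<noteq> ts ! Suc j" using dist[of j "Suc j"] j by simp
        from const[OF L[OF Suc.prems(2)] L[OF j] this pq(1) sub no[OF sub(1) pq(1)] \<open>{p,q} \<noteq> {z,a}\<close>]
        show ?thesis .
      qed
      then show ?thesis using Suc.hyps(1)[of "Suc j"] Suc.hyps(2) Suc.prems j by simp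
    qed
  qed
  have outside: "F t = 0" if "lattice_tri t" "t \<noteq> ts ! Suc k" "\<And>l. l \<le> k \<Longrightarrow> t \<noteq> ts ! l" for t
  proof (cases "t \<in> set ts")
    case True
    then obtain j where "j < length ts" "t = ts ! j" by (auto simp: in_set_conv_nth)
    moreover have "Suc k < j" using that calculation by (metis Suc_leI le_less_linear le_neq_implies_less not_less_eq_eq)
    ultimately show ?thesis using later by simp
  qed (use that missing in auto)
  \<comment> \<open>\<open>ts ! Suc k\<close> is left through its two new sides. The walk avoids
    \<open>{b,z}\<close> and uses \<open>{z,a}\<close> once, so the value there would have to be 0
    and different from 0.\<close>
  obtain t1 where t1: "lattice_tri t1" "t1 \<noteq> ts ! Suc k" "{b,z} \<subseteq> t1"
    using other_tri_exists[OF L[OF k], of b z] za tm by auto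
  obtain t2 where t2: "lattice_tri t2" "t2 \<noteq> ts ! Suc k" "{z,a} \<subseteq> t2"
    using other_tri_exists[OF L[OF k], of z a] za tm by auto
  have "F t1 = 0" "F t2 = 0" using outside t1 t2 no_za by blast+
  moreover have "F (ts ! Suc k) = F t1"
    using t1 no_za L[OF k] tm za ab by (intro const[of _ _ b z]) (auto simp: doubleton_eq_iff)
  moreover have "F (ts ! Suc k) \<noteq> F t2"
    using t2 L[OF k] tm by (intro jump) auto
  ultimately show False by simp
qed

section \<open>Degrees and subchains\<close>

text \<open>Iterating \<open>tri_chain_no_return\<close>: the triangles at a vertex have consecutive
  indices.\<close>

lemma vertex_interval:
  assumes ch: "tri_chain ts" and "l \<le> m" "m \<le> k" "k < length ts" "x \<in> ts ! l" "x \<in> ts ! k"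
  shows "x \<in> ts ! m"
  using assms(3,4,6)
proof (induction rule: dec_induct)
  case base
  then show ?case by simp
next
  case (step j)
  then show ?case using tri_chain_no_return[OF ch, of j l x] assms(2,5) by simp
qed

lemma sides_insert3:
  assumes "a \<noteq> b" "a \<noteq> c" "b \<noteq> c"
  shows "sides {a,b,c} = {{a,b},{a,c},{b,c}}"
proof
  show "sides {a,b,c} \<subseteq> {{a,b},{a,c},{b,c}}"
  proof
    fix e assume "e \<in> sides {a,b,c}"
    then obtain x y where "e = {x,y}" "x \<noteq> y" "x \<in> {a,b,c}" "y \<in> {a,b,c}"
      unfolding sides_def card_2_iff by blast
    then show "e \<in> {{a,b},{a,c},{b,c}}"
      by (elim insertE emptyE) (simp_all add: insert_commute)
  qed
  show "{{a,b},{a,c},{b,c}} \<subseteq> sides {a,b,c}"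
    unfolding sides_def using assms by auto
qed

text \<open>The part of \<open>tri_chain\<close> that the degree count relies on. It passes to a
  prefix without any argument about regions of the complement, which makes \<open>rev_induct\<close>
  possible.\<close>

definition strip :: "(int \<times> int) set list \<Rightarrow> bool" where
  "strip ts \<longleftrightarrow> (\<forall>t\<in>set ts. card t = 3) \<and>
     (\<forall>k. Suc k < length ts \<longrightarrow> card (ts ! k \<inter> ts ! Suc k) = 2 \<and> (\<forall>i\<le>k. ts ! i \<inter> ts ! Suc k \<subseteq> ts ! k))"

lemma strip_tri_chain: "tri_chain ts \<Longrightarrow> strip ts"
  using tri_chain_no_return lattice_tri_card
  by (auto simp: strip_def tri_chain_def shares_side_def)

lemma strip_snocD:
  assumes "strip (ts @ [t])"
  shows "strip ts"
proof -
  have "(ts @ [t]) ! i = ts ! i" if "i < length ts" for i using that by (simp add: nth_append)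
  moreover have "card ((ts @ [t]) ! k \<inter> (ts @ [t]) ! Suc k) = 2 \<and>
      (\<forall>i\<le>k. (ts @ [t]) ! i \<inter> (ts @ [t]) ! Suc k \<subseteq> (ts @ [t]) ! k)" if "Suc k < length ts" for k
    using assms that unfolding strip_def by (metis length_append_singleton less_SucI)
  ultimately show ?thesis using assms unfolding strip_def by (simp add: Suc_lessD)
qed

lemma finite_fig_edges: "strip ts \<Longrightarrow> finite (fig_edges ts)"
proof -
  assume "strip ts"
  then have "finite (sides t)" if "t \<in> set ts" for t
  proof -
    have "finite t" using \<open>strip ts\<close> that by (intro card_ge_0_finite) (simp add: strip_def)
    then show ?thesis by (auto simp: sides_def intro: finite_subset[of _ "Pow t"])
  qed
  then show ?thesis by (simp add: fig_edges_def)
qed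

lemma strip_snocE:
  assumes st: "strip (ts @ [t])" and "ts \<noteq> []"
  obtains a b w where "t = {a,b,w}" "a \<noteq> b" "w \<notin> fig_verts ts" "a \<in> fig_verts ts" "b \<in> fig_verts ts"
    "fig_edges (ts @ [t]) = fig_edges ts \<union> {{a,w},{b,w}}"
proof -
  obtain k where k: "length ts = Suc k" using assms(2) by (cases ts) auto
  have c: "card (ts ! k \<inter> t) = 2" "\<And>i. i \<le> k \<Longrightarrow> ts ! i \<inter> t \<subseteq> ts ! k"
  proof -
    have nth: "(ts @ [t]) ! i = ts ! i" if "i \<le> k" for i using that k by (simp add: nth_append)
    have last: "(ts @ [t]) ! Suc k = t" using k by (metis nth_append_length)
    have *: "card ((ts @ [t]) ! k \<inter> (ts @ [t]) ! Suc k) = 2"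
      "\<And>i. i \<le> k \<Longrightarrow> (ts @ [t]) ! i \<inter> (ts @ [t]) ! Suc k \<subseteq> (ts @ [t]) ! k"
      using st k unfolding strip_def by auto
    show "card (ts ! k \<inter> t) = 2" using *(1) nth[of k] last by simp
    show "ts ! i \<inter> t \<subseteq> ts ! k" if "i \<le> k" for i using *(2)[OF that] nth[of k] nth[OF that] last by simp
  qed
  have "card t = 3" using st by (simp add: strip_def)
  obtain a b where ab: "a \<noteq> b" "ts ! k \<inter> t = {a,b}" using c(1) by (auto simp: card_2_iff)
  obtain w where w: "t = {a,b,w}" "w \<noteq> a" "w \<noteq> b"
    using card3_third[OF \<open>card t = 3\<close>, of a b] ab by blast
  have wk: "w \<notin> ts ! k" using ab w by auto
  have "w \<notin> fig_verts ts"
  proof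
    assume "w \<in> fig_verts ts"
    then obtain i where "i \<le> k" "w \<in> ts ! i"
      using k by (auto simp: fig_verts_def in_set_conv_nth less_Suc_eq_le)
    then show False using c(2)[of i] wk w by blast
  qed
  moreover have "ts ! k \<in> set ts" using k by simp
  moreover have "{a,b} \<in> sides (ts ! k)" using ab by (auto simp: sides_def)
  moreover have "sides t = {{a,b},{a,w},{b,w}}" using w ab sides_insert3 by metis
  ultimately show thesis
  proof (intro that[of a b w])
    show "a \<in> fig_verts ts" "b \<in> fig_verts ts"
      using ab \<open>ts ! k \<in> set ts\<close> unfolding fig_verts_def by blast+
    have "{a,b} \<in> fig_edges ts"
      using \<open>ts ! k \<in> set ts\<close> \<open>{a,b} \<in> sides (ts ! k)\<close> unfolding fig_edges_def by blast
    then show "fig_edges (ts @ [t]) = fig_edges ts \<union> {{a,w},{b,w}}"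
      using \<open>sides t = {{a,b},{a,w},{b,w}}\<close> unfolding fig_edges_def by simp blast
  qed (use ab w in auto)
qed

text \<open>The triangles at a vertex form a fan, which has one more edge at the vertex than
  triangles. In the induction the appended triangle gives its new vertex two edges and each endpoint
  of its old side one.\<close>

lemma deg_strip:
  assumes "strip ts" "u \<in> fig_verts ts"
  shows "deg ts u = Suc (length (filter (\<lambda>t. u \<in> t) ts))"
  using assms
proof (induction ts rule: rev_induct)
  case Nil
  then show ?case by (simp add: fig_verts_def)
next
  case (snoc t ts)
  show ?case
  proof (cases "ts = []")
    case True
    then obtain a b c where t: "t = {a,b,c}" "a \<noteq> b" "a \<noteq> c" "b \<noteq> c"
      using snoc.prems(1) by (auto simp: strip_def card_3_iff)
    have u: "u = a \<or> u = b \<or> u = c" using snoc.prems(2) t True by (auto simp: fig_verts_def)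
    have "{e \<in> sides t. u \<in> e} = (if u = a then {{a,b},{a,c}} else if u = b then {{a,b},{b,c}} else {{a,c},{b,c}})"
      using t u by (auto simp: sides_insert3)
    then show ?thesis using True t u
      by (auto simp: deg_def fig_edges_def doubleton_eq_iff)
  next
    case False
    obtain a b w where t: "t = {a,b,w}" "a \<noteq> b" and w: "w \<notin> fig_verts ts"
      and ab: "a \<in> fig_verts ts" "b \<in> fig_verts ts"
      and E: "fig_edges (ts @ [t]) = fig_edges ts \<union> {{a,w},{b,w}}"
      using strip_snocE[OF snoc.prems(1) False] .
    have wE: "w \<notin> e" if "e \<in> fig_edges ts" for e
      using that w by (auto simp: fig_edges_def fig_verts_def sides_def)
    have wab: "w \<noteq> a" "w \<noteq> b" using w ab by auto
    have fin: "finite (fig_edges ts)" using finite_fig_edges strip_snocD[OF snoc.prems(1)] .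
    have IH: "u \<in> fig_verts ts \<Longrightarrow> deg ts u = Suc (length (filter (\<lambda>t. u \<in> t) ts))"
      using snoc.IH strip_snocD[OF snoc.prems(1)] by simp
    have split: "{e \<in> fig_edges (ts @ [t]). u \<in> e} = {e \<in> fig_edges ts. u \<in> e} \<union> {e \<in> {{a,w},{b,w}}. u \<in> e}"
      unfolding E by auto
    have deg: "deg (ts @ [t]) u = deg ts u + card {e \<in> {{a,w},{b,w}}. u \<in> e}"
      unfolding deg_def split using fin wE by (intro card_Un_disjoint) auto
    show ?thesis
    proof (cases "u = w")
      case True
      have "filter (\<lambda>t. u \<in> t) ts = []" using w True by (auto simp: filter_empty_conv fig_verts_def)
      moreover have "deg ts u = 0"
      proof -
        have "{e \<in> fig_edges ts. u \<in> e} = {}" using wE True by blast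
        then show ?thesis unfolding deg_def by (metis card.empty)
      qed
      moreover have "{e \<in> {{a,w},{b,w}}. u \<in> e} = {{a,w},{b,w}}" using True by auto
      ultimately show ?thesis using deg True t wab by (simp add: doubleton_eq_iff)
    next
      case uw: False
      have "{e \<in> {{a,w},{b,w}}. u \<in> e} = (if u = a then {{a,w}} else if u = b then {{b,w}} else {})"
        using uw t(2) by auto
      moreover have "u \<in> fig_verts ts" using snoc.prems(2) t ab uw by (auto simp: fig_verts_def)
      ultimately show ?thesis using deg IH t uw by auto
    qed
  qed
qed

section \<open>Subchains are triangular chains\<close>

lemma length_subchain: "i \<le> j \<Longrightarrow> j < length ts \<Longrightarrow> length (subchain ts i j) = Suc j - i"
  by (simp add: subchain_def)

lemma nth_subchain: "i \<le> j \<Longrightarrow> j < length ts \<Longrightarrow> k < Suc j - i \<Longrightarrow> subchain ts i j ! k = ts ! (i + k)"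
  by (simp add: subchain_def)

lemma set_subchain:
  assumes "i \<le> j" "j < length ts"
  shows "set (subchain ts i j) = (!) ts ` {i..j}"
proof -
  have "set (subchain ts i j) = (\<lambda>k. ts ! (i + k)) ` {..<Suc j - i}"
    using assms by (force simp: set_conv_nth length_subchain nth_subchain)
  also have "\<dots> = (!) ts ` ((+) i ` {..<Suc j - i})" by (simp add: image_image)
  also have "(+) i ` {..<Suc j - i} = {i..j}"
  proof -
    have "k = i + (k - i)" "k - i < Suc j - i" if "k \<in> {i..j}" for k using that by auto
    then show ?thesis by (fastforce simp: image_iff)
  qed
  finally show ?thesis .
qed

lemma missing_adj_mono: "set ts' \<subseteq> set ts \<Longrightarrow> missing_adj ts \<subseteq> missing_adj ts'"
  by (auto simp: missing_adj_def)

text \<open>A dropped triangle joins the complement of the subchain. From it one walks away from the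
  interval \<open>{i..j}\<close> to the end of the chain on that side and leaves there.\<close>

lemma outside_reaches_missing:
  assumes ch: "tri_chain ts" and ij: "i \<le> j" "j < length ts" and k: "k < length ts" "k \<notin> {i..j}"
  shows "\<exists>t. lattice_tri t \<and> t \<notin> set ts \<and> (ts ! k, t) \<in> (missing_adj (subchain ts i j))\<^sup>*"
proof -
  let ?M = "missing_adj (subchain ts i j)"
  have n2: "2 \<le> length ts" using ij k by auto
  have out: "ts ! l \<notin> set (subchain ts i j)" if "l < length ts" "l \<notin> {i..j}" for l
    using ch that ij by (auto simp: set_subchain tri_chain_def nth_eq_iff_index_eq)
  have sub: "set (subchain ts i j) \<subseteq> set ts" using ij by (auto simp: set_subchain)
  have end_case: "\<exists>t. lattice_tri t \<and> t \<notin> set ts \<and> (ts ! e, t) \<in> ?M\<^sup>*"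
    if e: "e = 0 \<and> e' = 1 \<or> Suc e = length ts \<and> e = Suc e'" "e \<notin> {i..j}" for e e'
  proof -
    obtain p r t where t: "p \<noteq> r" "{p,r} \<subseteq> ts ! e" "lattice_tri t" "t \<notin> set ts" "{p,r} \<subseteq> t"
      using tri_chain_ends_missing[OF ch n2 e(1)] by metis
    have el: "e < length ts" using e n2 by auto
    have "shares_side (ts ! e) t"
      using shares_side_if_common_side[of "ts ! e" t p r] t tri_chain_lattice[OF ch el] el nth_mem by metis
    then have "(ts ! e, t) \<in> ?M"
      using t out[OF el e(2)] sub tri_chain_lattice[OF ch el] by (auto simp: missing_adj_def)
    then show ?thesis using t by blast
  qed
  have adj: "(ts ! l, ts ! l') \<in> ?M"
    if "l < length ts" "l' < length ts" "l \<notin> {i..j}" "l' \<notin> {i..j}" "l' = Suc l \<or> l = Suc l'" for l l'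
  proof -
    have "shares_side (ts ! l) (ts ! l')"
      using that ch unfolding tri_chain_def by (metis lessI shares_side_commute)
    then show ?thesis using that out tri_chain_lattice[OF ch] by (auto simp: missing_adj_def)
  qed
  show ?thesis
  proof (cases "k < i")
    case True
    then show ?thesis using k
    proof (induction k)
      case 0
      then show ?case using end_case[of 0 1] by simp
    next
      case (Suc k)
      then have "(ts ! Suc k, ts ! k) \<in> ?M" by (intro adj) auto
      then show ?case using Suc by (auto intro: converse_rtrancl_into_rtrancl)
    qed
  next
    case False
    then have "j < k" using k by simp
    then show ?thesis using k(1)
    proof (induction "length ts - k" arbitrary: k)
      case 0
      then show ?case by simp
    next
      case (Suc d)
      show ?case
      proof (cases "Suc k = length ts")
        case True
        then show ?thesis using end_case[of k "k - 1"] Suc.prems by simp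
      next
        case False
        then have "(ts ! k, ts ! Suc k) \<in> ?M" using Suc.prems by (intro adj) auto
        moreover obtain t where "lattice_tri t \<and> t \<notin> set ts \<and> (ts ! Suc k, t) \<in> ?M\<^sup>*"
        proof -
          have "d = length ts - Suc k" "j < Suc k" "Suc k < length ts" using Suc.hyps(2) Suc.prems False by auto
          then show thesis using Suc.hyps(1)[of "Suc k"] that by blast
        qed
        ultimately show ?thesis by (blast intro: converse_rtrancl_into_rtrancl)
      qed
    qed
  qed
qed

text \<open>Every region of the larger complement contains a whole region of the complement of
  \<open>ts\<close>, hence is infinite.\<close>

lemma tri_chain_subchain:
  assumes ch: "tri_chain ts" and ij: "i \<le> j" "j < length ts"
  shows "tri_chain (subchain ts i j)"
proof -
  let ?s = "subchain ts i j"
  have sub: "set ?s \<subseteq> set ts" using ij by (auto simp: set_subchain)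
  have "infinite {t'. (t,t') \<in> (missing_adj ?s)\<^sup>*}" if t: "lattice_tri t" "t \<notin> set ?s" for t
  proof -
    obtain t0 where t0: "lattice_tri t0" "t0 \<notin> set ts" "(t,t0) \<in> (missing_adj ?s)\<^sup>*"
    proof (cases "t \<in> set ts")
      case True
      then obtain k where k: "k < length ts" "t = ts ! k" by (auto simp: in_set_conv_nth)
      then have "k \<notin> {i..j}" using t ij by (auto simp: set_subchain)
      then show thesis using outside_reaches_missing[OF ch ij k(1)] k that by auto
    next
      case False
      then show thesis using that[of t] t by auto
    qed
    have "(missing_adj ts)\<^sup>* \<subseteq> (missing_adj ?s)\<^sup>*" using missing_adj_mono[OF sub] by (rule rtrancl_mono)
    then have "{t'. (t0,t') \<in> (missing_adj ts)\<^sup>*} \<subseteq> {t'. (t,t') \<in> (missing_adj ?s)\<^sup>*}"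
      using t0(3) by (auto intro: rtrancl_trans)
    moreover have "infinite {t'. (t0,t') \<in> (missing_adj ts)\<^sup>*}" using ch t0 unfolding tri_chain_def by blast
    ultimately show ?thesis using infinite_super by blast
  qed
  moreover have "shares_side (?s ! x) (?s ! y) \<longleftrightarrow> y = Suc x" if "x < y" "y < length ?s" for x y
    using that ij ch by (simp add: nth_subchain length_subchain tri_chain_def)
  moreover have "?s \<noteq> []" using ij by (simp add: subchain_def)
  moreover have "distinct ?s" using ch by (simp add: subchain_def tri_chain_def)
  ultimately show ?thesis using sub ch unfolding tri_chain_def by blast
qed

lemma induced_subchain:
  assumes ch: "tri_chain ts" and ij: "i \<le> j" "j < length ts"
  shows "induced_in ts (subchain ts i j)"
proof -
  have "e \<in> fig_edges (subchain ts i j)" if e: "e \<in> fig_edges ts" "e \<subseteq> fig_verts (subchain ts i j)" for e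
  proof -
    obtain k where k: "k < length ts" "e \<subseteq> ts ! k" "card e = 2"
      using e by (auto simp: fig_edges_def sides_def in_set_conv_nth)
    have "\<exists>m\<in>{i..j}. e \<subseteq> ts ! m"
    proof (cases "k \<in> {i..j}")
      case True
      then show ?thesis using k by blast
    next
      case False
      \<comment> \<open>Each endpoint occurs in triangle \<open>k\<close> and again inside
        \<open>{i..j}\<close>, hence in the border triangle between them; so the whole edge lies in
        that one triangle.\<close>
      have "x \<in> ts ! (if k < i then i else j)" if x: "x \<in> e" for x
      proof -
        obtain l where "l \<in> {i..j}" "x \<in> ts ! l" using x e ij by (auto simp: fig_verts_def set_subchain)
        then show ?thesis
          using vertex_interval[OF ch, of k i l x] vertex_interval[OF ch, of l j k x] x k False ij by auto
      qed
      then show ?thesis using ij by (intro bexI[of _ "if k < i then i else j"]) auto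
    qed
    then show ?thesis using k ij by (auto simp: fig_edges_def sides_def set_subchain)
  qed
  moreover have "e \<in> fig_edges ts \<and> e \<subseteq> fig_verts (subchain ts i j)" if "e \<in> fig_edges (subchain ts i j)" for e
    using that ij by (auto simp: fig_edges_def fig_verts_def sides_def set_subchain)
  ultimately show ?thesis unfolding induced_in_def by blast
qed

lemma deg_tri_chain:
  assumes "tri_chain ts" "u \<in> fig_verts ts"
  shows "deg ts u = Suc (card {k. k < length ts \<and> u \<in> ts ! k})"
  using deg_strip[OF strip_tri_chain] assms by (simp add: length_filter_conv_card)

text \<open>Degree at most 4 means at most three triangles. Points off the subchain count 0, so
  \<open>u\<close> may range over all points.\<close>

lemma lin_piece_iff:
  assumes ch: "tri_chain ts"
  shows "lin_piece ts i j \<longleftrightarrow> i \<le> j \<and> j < length ts \<and> (\<forall>u. card {k \<in> {i..j}. u \<in> ts ! k} \<le> 3)"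
proof (cases "i \<le> j \<and> j < length ts")
  case True
  then have ij: "i \<le> j" "j < length ts" by auto
  let ?s = "subchain ts i j"
  note sc = tri_chain_subchain[OF ch ij]
  have card_eq: "card {k. k < length ?s \<and> u \<in> ?s ! k} = card {k \<in> {i..j}. u \<in> ts ! k}" for u
  proof (rule bij_betw_same_card[of "(+) i"])
    show "bij_betw ((+) i) {k. k < length ?s \<and> u \<in> ?s ! k} {k \<in> {i..j}. u \<in> ts ! k}"
      by (rule bij_betw_byWitness[of _ "\<lambda>k. k - i"])
        (use ij in \<open>auto simp: length_subchain nth_subchain\<close>)
  qed
  have "(\<forall>u\<in>fig_verts ?s. deg ?s u \<le> 4) \<longleftrightarrow> (\<forall>u. card {k \<in> {i..j}. u \<in> ts ! k} \<le> 3)"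
  proof -
    have "card {k \<in> {i..j}. u \<in> ts ! k} = 0" if "u \<notin> fig_verts ?s" for u
      using that ij by (auto simp: fig_verts_def set_subchain)
    moreover have "deg ?s u = Suc (card {k \<in> {i..j}. u \<in> ts ! k})" if "u \<in> fig_verts ?s" for u
      using deg_tri_chain[OF sc that] card_eq by simp
    ultimately show ?thesis by (smt (verit) Suc_le_mono eval_nat_numeral(2,3) numeral_3_eq_3 semiring_norm(26,27) zero_le)
  qed
  then show ?thesis using ij sc induced_subchain[OF ch ij] by (simp add: lin_piece_def linear_chain_def)
qed (auto simp: lin_piece_def)

section \<open>Labelling the vertices\<close>

text \<open>The vertices are numbered in the order in which they enter the chain. For \<open>q \<in> Q\<close> the
  triangles from \<open>q - 3\<close> to \<open>q\<close> all contain \<open>v (q - 1)\<close>, so this vertex has degree 5.\<close>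

locale labelled_chain =
  fixes ts :: "(int \<times> int) set list" and n :: nat and v :: "nat \<Rightarrow> int \<times> int" and Q :: "nat set"
  assumes chain: "tri_chain ts" and len: "length ts = n" and n4: "4 \<le> n"
    and inj: "inj_on v {..n+1}" and Q_sub: "Q \<subseteq> {3..<n}" and Q_gap: "\<And>q. q \<in> Q \<Longrightarrow> Suc q \<notin> Q"
    and nth_ts: "\<And>k. k < n \<Longrightarrow> ts ! k = {v (if k \<in> Q then k - 1 else k), v (k + 1), v (k + 2)}"

lemma ex_labelled_chain:
  assumes ch: "tri_chain ts" and len: "length ts = n" and n4: "4 \<le> n"
    and deg: "\<And>u. u \<in> fig_verts ts \<Longrightarrow> deg ts u \<le> 5"
  shows "\<exists>v Q. labelled_chain ts n v Q"
proof -
  have c3: "card (ts ! k) = 3" "finite (ts ! k)" if "k < n" for k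
    using lattice_tri_card tri_chain_lattice[OF ch] that len by auto
  have c2: "card (ts ! k \<inter> ts ! Suc k) = 2" if "Suc k < n" for k
    using ch that len by (simp add: tri_chain_def shares_side_def)
  have "\<exists>x. Suc k < n \<longrightarrow> ts ! Suc k - ts ! k = {x}" for k
  proof (cases "Suc k < n")
    case True
    then have "card (ts ! Suc k - ts ! k) = 1"
      using card_Diff_subset_Int[of "ts ! Suc k" "ts ! k"] c3 c2[OF True] by (simp add: Int_commute)
    then show ?thesis by (auto simp: card_1_singleton_iff)
  qed simp
  \<comment> \<open>\<open>w k\<close> is the vertex entering with triangle \<open>k + 1\<close>;
    below, \<open>r k\<close> is the vertex dropped from triangle \<open>k\<close>.\<close>
  then obtain w where w: "\<And>k. Suc k < n \<Longrightarrow> ts ! Suc k - ts ! k = {w k}" by metis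
  have "\<exists>x. Suc k < n \<longrightarrow> ts ! k - ts ! Suc k = {x}" for k
  proof (cases "Suc k < n")
    case True
    then have "card (ts ! k - ts ! Suc k) = 1"
      using card_Diff_subset_Int[of "ts ! k" "ts ! Suc k"] c3 c2[OF True] by simp
    then show ?thesis by (auto simp: card_1_singleton_iff)
  qed simp
  then obtain r where r: "\<And>k. Suc k < n \<Longrightarrow> ts ! k - ts ! Suc k = {r k}" by metis
  have step: "ts ! Suc k = insert (w k) (ts ! k - {r k})" if "Suc k < n" for k
    using w[OF that] r[OF that] by blast
  \<comment> \<open>If the vertex that has just entered were dropped next, the common side of
    triangles \<open>k\<close> and \<open>k + 1\<close> would also lie in triangle
    \<open>k + 2\<close>.\<close>
  have r_old: "r (Suc k) \<noteq> w k" if k: "Suc (Suc k) < n" for k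
  proof
    assume eq: "r (Suc k) = w k"
    have "ts ! k \<inter> ts ! Suc k \<subseteq> ts ! Suc (Suc k)"
      using eq w[of k] r[of "Suc k"] k by auto
    moreover obtain p q where "p \<noteq> q" "ts ! k \<inter> ts ! Suc k = {p,q}"
      using c2[of k] k by (auto simp: card_2_iff)
    ultimately show False
      using tri_chain_side_consecutive[OF ch, of k "Suc (Suc k)" p q] k len by auto
  qed
  have r0: "r 0 \<in> ts ! 0" "r 0 \<notin> ts ! 1" using r[of 0] n4 by auto
  have r1: "r 1 \<in> ts ! 1" "r 1 \<noteq> w 0" using r[of 1] n4 r_old[of 0] by auto
  have r10: "r 1 \<in> ts ! 0" using r1 w[of 0] n4 by auto
  have "r 0 \<noteq> r 1" using r0 r1 by auto
  then obtain c where c: "ts ! 0 = {r 0, r 1, c}" "c \<noteq> r 0" "c \<noteq> r 1"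
    using card3_third[OF c3(1)[of 0]] n4 r0 r10 by (metis gr0I not_numeral_le_zero)
  \<comment> \<open>The first triangle is ordered by the dropping of its vertices. So triangles 1
    and 2 follow the regular pattern, and the first turn possible is 3.\<close>
  define v where "v = (\<lambda>j. if j = 0 then r 0 else if j = 1 then r 1 else if j = 2 then c else w (j - 3))"
  have v_new: "v (k + 3) = w k" for k by (simp add: v_def)
  have t0: "ts ! 0 = {v 0, v 1, v 2}" using c by (simp add: v_def)
  have in0: "v (k + 2) \<in> ts ! k" if "k < n" for k
  proof (cases k)
    case 0
    then show ?thesis using t0 by (simp add: numeral_2_eq_2)
  next
    case (Suc l)
    then show ?thesis using w[of l] that v_new[of l] by (auto simp: eval_nat_numeral)
  qed
  have new: "v (k + 2) \<notin> ts ! i" if ik: "i < k" "k < n" for i k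
  proof -
    obtain l where l: "k = Suc l" using ik by (cases k) auto
    have "w l \<notin> ts ! l" "w l \<in> ts ! Suc l" using w[of l] that l by auto
    then have "w l \<notin> ts ! i"
      using vertex_interval[OF ch, of i l "Suc l" "w l"] that l len by auto
    then show ?thesis using v_new[of l] l by (simp add: eval_nat_numeral)
  qed
  have "v j \<noteq> v j'" if jj: "j < j'" "j' \<le> n + 1" for j j'
  proof (cases "j' \<le> 2")
    case True
    then have "j' = 1 \<and> j = 0 \<or> j' = 2 \<and> j = 0 \<or> j' = 2 \<and> j = 1" using jj by auto
    then show ?thesis using c \<open>r 0 \<noteq> r 1\<close> by (auto simp: v_def)
  next
    case False
    then have eq: "j' - 2 + 2 = j'" by simp
    have "v j' \<notin> ts ! (j - 2)" using new[of "j - 2" "j' - 2"] jj False unfolding eq by simp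
    moreover have "v j \<in> ts ! (j - 2)"
    proof (cases "j < 2")
      case True
      then have "j = 0 \<or> j = 1" by auto
      then show ?thesis using t0 by auto
    next
      case False
      then have "j - 2 + 2 = j" by simp
      then show ?thesis using in0[of "j - 2"] jj by simp
    qed
    ultimately show ?thesis by auto
  qed
  then have inj: "inj_on v {..n+1}" by (intro linorder_inj_onI) auto
  have t2: "ts ! 2 = {v 2, v 3, v 4}"
  proof -
    have "ts ! 1 = {v 1, v 2, v 3}"
      using step[of 0] n4 c \<open>r 0 \<noteq> r 1\<close> by (auto simp: v_def)
    moreover have "r 1 = v 1" "w 1 = v 4" by (auto simp: v_def)
    moreover have "v 1 \<noteq> v 2" "v 1 \<noteq> v 3" using inj n4 by (auto simp: inj_on_eq_iff)
    ultimately show ?thesis using step[of 1] n4 by (auto simp: numeral_2_eq_2)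
  qed
  \<comment> \<open>Five triangles at a vertex would give it degree 6.\<close>
  have no5: "\<not> (u \<in> ts ! k \<and> u \<in> ts ! (k + 4))" if "k + 4 < n" for u k
  proof
    assume u: "u \<in> ts ! k \<and> u \<in> ts ! (k + 4)"
    then have "u \<in> fig_verts ts" using that len by (auto simp: fig_verts_def)
    then have "card {l. l < n \<and> u \<in> ts ! l} \<le> 4" using deg deg_tri_chain[OF ch] len by fastforce
    moreover have "{k..k+4} \<subseteq> {l. l < n \<and> u \<in> ts ! l}"
      using vertex_interval[OF ch, of k _ "k + 4" u] u that len by auto
    then have "card {k..k+4} \<le> card {l. l < n \<and> u \<in> ts ! l}" by (intro card_mono) auto
    ultimately show False by simp
  qed
  have form: "ts ! k = {v k, v (k + 1), v (k + 2)} \<or> 3 \<le> k \<and> ts ! k = {v (k - 1), v (k + 1), v (k + 2)}"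
    if "2 \<le> k" "k < n" for k
    using that
  proof (induction rule: dec_induct)
    case base
    then show ?case using t2 by simp
  next
    case (step k)
    have tS: "ts ! Suc k = insert (v (k + 3)) (ts ! k - {r k})"
      using \<open>\<And>k. Suc k < n \<Longrightarrow> ts ! Suc k = insert (w k) (ts ! k - {r k})\<close> step.prems v_new by simp
    obtain l where l: "k = Suc l" using step.hyps by (cases k) auto
    have "r k \<noteq> v (k + 2)" using r_old[of l] v_new[of l] l step.prems by (simp add: eval_nat_numeral)
    moreover have "r k \<in> ts ! k" using r[OF step.prems] by blast
    moreover have *: "v (k + 2) \<noteq> v (k + 1)" "v (k + 1) \<noteq> v k" "v (k + 2) \<noteq> v k"
      "v (k + 2) \<noteq> v (k - 1)" "v (k + 1) \<noteq> v (k - 1)"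
      using inj step.prems by (auto simp: inj_on_eq_iff)
    ultimately consider "r k = v (k + 1)" "ts ! k = {v k, v (k + 1), v (k + 2)}"
      | "r k = v (k + 1)" "3 \<le> k" "ts ! k = {v (k - 1), v (k + 1), v (k + 2)}"
      | "ts ! k - {r k} = {v (k + 1), v (k + 2)}"
      using step.IH step.prems by auto
    then show ?case
    proof cases
      case 1
      then show ?thesis using tS step.hyps * by (auto simp: eval_nat_numeral)
    next
      \<comment> \<open>A turn right after a turn would keep \<open>v (k - 1)\<close> in all
        triangles from \<open>k - 3\<close> to \<open>k + 1\<close>.\<close>
      case 2
      then have "v (k - 1) \<in> ts ! Suc k" using tS * by auto
      moreover have "v (k - 1) \<in> ts ! (k - 3)" 
      proof -
        have "k - 3 + 2 = k - 1" using 2(2) by simp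
        then show ?thesis using in0[of "k - 3"] step.prems by simp
      qed
      ultimately show ?thesis using no5[of "k - 3" "v (k - 1)"] 2(2) step.prems by simp
    next
      case 3
      then show ?thesis using tS by (auto simp: eval_nat_numeral)
    qed
  qed
  define Q where "Q = {k \<in> {3..<n}. ts ! k = {v (k - 1), v (k + 1), v (k + 2)}}"
  have "labelled_chain ts n v Q"
  proof
    show "Q \<subseteq> {3..<n}" by (auto simp: Q_def)
    show "Suc q \<notin> Q" if q: "q \<in> Q" for q
    proof
      \<comment> \<open>\<open>v q\<close> enters with triangle \<open>q - 2\<close> and is dropped
        by the turn \<open>q\<close>; a turn at \<open>Suc q\<close> would bring it back.\<close>
      assume "Suc q \<in> Q"
      then have "v q \<in> ts ! Suc q" "Suc q < n" by (auto simp: Q_def)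
      moreover have "v q \<in> ts ! (q - 2)" 
      proof -
        have "q - 2 + 2 = q" "q < n" using q by (auto simp: Q_def)
        then show ?thesis using in0[of "q - 2"] by simp
      qed
      ultimately have "v q \<in> ts ! q" using vertex_interval[OF ch, of "q - 2" q "Suc q"] len by simp
      then show False using q inj \<open>Suc q < n\<close> by (auto simp: Q_def inj_on_eq_iff)
    qed
    show "ts ! k = {v (if k \<in> Q then k - 1 else k), v (k + 1), v (k + 2)}" if "k < n" for k
    proof (cases "2 \<le> k")
      case True
      then show ?thesis using form[OF True that] that unfolding Q_def by auto
    next
      case False
      then have "k = 0 \<or> k = 1" by auto
      moreover have "ts ! 1 = {v 1, v 2, v 3}"
        using step[of 0] n4 c \<open>r 0 \<noteq> r 1\<close> by (auto simp: v_def)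
      ultimately show ?thesis using t0 by (auto simp: Q_def eval_nat_numeral)
    qed
  qed (use ch len n4 inj in auto)
  then show ?thesis by blast
qed

lemma symmetric_Min_Max_doubleton:
  fixes p q :: "'a::linorder" and \<theta> :: "nat \<Rightarrow> nat \<Rightarrow> real"
  assumes "\<And>a b. \<theta> a b = \<theta> b a"
  shows "\<theta> (f (Min {p,q})) (f (Max {p,q})) = \<theta> (f p) (f q)"
  using assms[of "f q" "f p"] by (auto simp: min_def max_def)

context labelled_chain
begin

definition lo :: "nat \<Rightarrow> nat" where "lo k = (if k \<in> Q then k - 1 else k)"

text \<open>The degree of \<open>v j\<close>. A turn \<open>q\<close> keeps \<open>v (q - 1)\<close>
  for one triangle more and drops \<open>v q\<close> one triangle early, whence 5 and 3 instead of
  4; the two labels at each end get 2 and 3.\<close>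

definition d :: "nat \<Rightarrow> nat" where
  "d j = (if j = 0 \<or> j = n + 1 then 2 else if j = 1 \<or> j = n then 3
          else if Suc j \<in> Q then 5 else if j \<in> Q then 3 else 4)"

lemma Q_bounds: "q \<in> Q \<Longrightarrow> 3 \<le> q \<and> q < n" using Q_sub by auto

lemma lo_le: "lo k \<le> k" by (simp add: lo_def)

lemma v_eq_iff: "i \<le> n + 1 \<Longrightarrow> j \<le> n + 1 \<Longrightarrow> v i = v j \<longleftrightarrow> i = j"
  using inj by (auto simp: inj_on_eq_iff)

lemma v_mem_iff:
  assumes "j \<le> n + 1" "k < n"
  shows "v j \<in> ts ! k \<longleftrightarrow> j = lo k \<or> j = k + 1 \<or> j = k + 2"
  using assms v_eq_iff[of j] lo_le[of k] by (auto simp: nth_ts lo_def[symmetric])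

lemma fig_verts_eq: "fig_verts ts = v ` {..n+1}"
proof
  show "fig_verts ts \<subseteq> v ` {..n+1}"
    using len by (fastforce simp: fig_verts_def in_set_conv_nth nth_ts)
  show "v ` {..n+1} \<subseteq> fig_verts ts"
  proof
    fix u assume "u \<in> v ` {..n+1}"
    then obtain j where j: "u = v j" "j \<le> n + 1" by auto
    have "0 \<notin> Q" using Q_bounds by force
    then have "v j \<in> ts ! (j - 2)" "j - 2 < n"
      using j n4 v_mem_iff[of j "j - 2"] by (auto simp: lo_def)
    then show "u \<in> fig_verts ts" using j len by (auto simp: fig_verts_def)
  qed
qed

lemma deg_v:
  assumes j: "j \<le> n + 1"
  shows "deg ts (v j) = d j"
proof -
  let ?S = "{k. k < n \<and> v j \<in> ts ! k}"
  have S: "?S = {k. k < n \<and> (j = lo k \<or> j = k + 1 \<or> j = k + 2)}" using v_mem_iff[OF j] by auto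
  have b: "Suc j \<in> Q \<Longrightarrow> 2 \<le> j \<and> Suc j < n \<and> j \<notin> Q" "j \<in> Q \<Longrightarrow> 3 \<le> j \<and> j < n \<and> Suc j \<notin> Q"
    using Q_bounds Q_gap by force+
  have dj: "deg ts (v j) = Suc (card ?S)"
    using deg_tri_chain[OF chain] j len by (simp add: fig_verts_eq)
  consider "j = 0" | "j = n + 1" | "j = 1" | "j = n" | "2 \<le> j" "j < n" "Suc j \<in> Q"
    | "2 \<le> j" "j < n" "j \<in> Q" | "2 \<le> j" "j < n" "Suc j \<notin> Q" "j \<notin> Q"
    using j by linarith
  then show ?thesis
  proof cases
    case 1
    then have "?S = {0}" unfolding S using b n4 Q_bounds by (auto simp: lo_def split: if_splits dest: Q_bounds)
    then show ?thesis using dj 1 by (simp add: d_def)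
  next
    case 2
    then have "?S = {n - 1}" unfolding S using b n4 by (auto simp: lo_def split: if_splits)
    then show ?thesis using dj 2 by (simp add: d_def)
  next
    case 3
    then have "?S = {0, 1}" unfolding S using b n4 by (auto simp: lo_def split: if_splits dest: Q_bounds)
    then show ?thesis using dj 3 n4 by (simp add: d_def)
  next
    case 4
    then have "?S = {n - 2, n - 1}" unfolding S using b n4 by (auto simp: lo_def split: if_splits)
    then show ?thesis using dj 4 n4 by (simp add: d_def)
  next
    case 5
    then have S5: "?S = {j - 2, j - 1, j, j + 1}" unfolding S using b n4 by (auto simp: lo_def split: if_splits)
    show ?thesis
    proof -
      have "card {j - 2, j - 1, j, j + 1} = 4" using 5(1) by (cases j rule: nat.exhaust; cases "j - 1") auto
      then show ?thesis using dj 5 S5 by (simp add: d_def)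
    qed
  next
    case 6
    then have "?S = {j - 2, j - 1}" unfolding S using b n4
      by (auto simp: lo_def split: if_splits dest: Q_bounds)
    then show ?thesis using dj 6 b by (simp add: d_def)
  next
    case 7
    then have "?S = {j - 2, j - 1, j}" unfolding S using b n4
      by (auto simp: lo_def split: if_splits dest: Q_bounds)
    moreover have "card {j - 2, j - 1, j} = 3" using 7(1) by (cases j rule: nat.exhaust; cases "j - 1") auto
    ultimately show ?thesis using dj 7 by (simp add: d_def)
  qed
qed

section \<open>The index in terms of the turning indices\<close>

lemma lo_lo_pred: "k \<in> Q \<Longrightarrow> lo (k - 1) = k - 1"
  using Q_gap[of "k - 1"] Q_bounds[of k] by (auto simp: lo_def)

text \<open>The side \<open>{lo k, k + 1}\<close> of triangle \<open>k\<close> need not be listed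
  separately: it joins consecutive labels if \<open>k\<close> is no turn, and otherwise it is the
  side \<open>{(k - 1) + 2, lo (k - 1)}\<close> of the preceding triangle. What remains is
  \<open>2n + 1\<close> edges.\<close>

lemma fig_edges_eq:
  "fig_edges ts = (`) v ` ((\<lambda>j. {j, j + 1}) ` {..n} \<union> (\<lambda>k. {k + 2, lo k}) ` {..<n})"
proof -
  have Q0: "0 \<notin> Q" using Q_bounds by force
  have "sides (ts ! k) = {v ` {lo k, k + 1}, v ` {k + 2, lo k}, v ` {k + 1, k + 2}}" if k: "k < n" for k
  proof -
    have "v (lo k) \<noteq> v (k + 1)" "v (lo k) \<noteq> v (k + 2)" "v (k + 1) \<noteq> v (k + 2)"
      using v_eq_iff[of "lo k" "k + 1"] v_eq_iff[of "lo k" "k + 2"] v_eq_iff[of "k + 1" "k + 2"] k lo_le[of k] by auto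
    then show ?thesis using sides_insert3[of "v (lo k)" "v (k + 1)" "v (k + 2)"] nth_ts[OF k]
      by (simp add: lo_def[symmetric] insert_commute)
  qed
  then have "fig_edges ts = (\<Union>k<n. {v ` {lo k, k + 1}, v ` {k + 2, lo k}, v ` {k + 1, k + 2}})"
    using len by (auto simp: fig_edges_def set_conv_nth)
  also have "\<dots> = (`) v ` (\<Union>k<n. {{lo k, k + 1}, {k + 2, lo k}, {k + 1, k + 2}})" by (simp add: image_UN)
  also have "(\<Union>k<n. {{lo k, k + 1}, {k + 2, lo k}, {k + 1, k + 2}}) =
      (\<lambda>j. {j, j + 1}) ` {..n} \<union> (\<lambda>k. {k + 2, lo k}) ` {..<n}" (is "?A = ?B")
  proof
    show "?A \<subseteq> ?B"
    proof
      fix e assume "e \<in> ?A"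
      then obtain k where k: "k < n" and e: "e = {lo k, k + 1} \<or> e = {k + 2, lo k} \<or> e = {k + 1, k + 2}"
        by blast
      have "{lo k, k + 1} \<in> ?B"
      proof (cases "k \<in> Q")
        case True
        then have "{lo k, k + 1} = {(k - 1) + 2, lo (k - 1)}" "k - 1 < n"
          using lo_lo_pred[OF True] Q_bounds[OF True] by (auto simp: lo_def)
        then show ?thesis by blast
      next
        case False
        then have "{lo k, k + 1} = {k, k + 1}" by (simp add: lo_def)
        then show ?thesis using k by (intro UnI1 image_eqI[of _ _ k]) auto
      qed
      moreover have "{k + 1, k + 2} \<in> ?B" using k by (intro UnI1 image_eqI[of _ _ "k + 1"]) auto
      ultimately show "e \<in> ?B" using e k by blast
    qed
    show "?B \<subseteq> ?A"
    proof
      fix e assume "e \<in> ?B"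
      then consider j where "j \<le> n" "e = {j, j + 1}" | k where "k < n" "e = {k + 2, lo k}" by blast
      then show "e \<in> ?A"
      proof cases
        case 1
        show ?thesis
        proof (cases j)
          case 0
          then have "e = {lo 0, 0 + 1}" using 1 Q0 by (simp add: lo_def)
          then show ?thesis using n4 by (intro UN_I[of 0]) auto
        next
          case (Suc k)
          then have "e = {k + 1, k + 2}" using 1 by simp
          then show ?thesis using 1 Suc by (intro UN_I[of k]) auto
        qed
      next
        case 2
        then show ?thesis by blast
      qed
    qed
  qed
  finally show ?thesis .
qed

lemma TI_eq_sums:
  fixes \<theta> :: "nat \<Rightarrow> nat \<Rightarrow> real"
  assumes sym: "\<And>a b. \<theta> a b = \<theta> b a"
  shows "TI \<theta> ts = (\<Sum>j\<le>n. \<theta> (d j) (d (j + 1))) + (\<Sum>k<n. \<theta> (d (k + 2)) (d (lo k)))"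
proof -
  let ?E1 = "(\<lambda>j. {j, j + 1}) ` {..n}" and ?E2 = "(\<lambda>k. {k + 2, lo k}) ` {..<n}"
  let ?g = "\<lambda>e. \<theta> (deg ts (Min e)) (deg ts (Max e))"
  have sub: "?E1 \<union> ?E2 \<subseteq> Pow {..n+1}" 
  proof -
    have "{k + 2, lo k} \<subseteq> {..n+1}" if "k < n" for k using lo_le[of k] that by auto
    then show ?thesis by fastforce
  qed
  have injv: "inj_on ((`) v) (?E1 \<union> ?E2)"
    using inj_on_image_Pow[OF inj] sub by (rule inj_on_subset)
  have disj: "?E1 \<inter> ?E2 = {}"
  proof -
    have "{j, j + 1} \<noteq> {k + 2, lo k}" for j k using lo_le[of k] by (auto simp: doubleton_eq_iff)
    then show ?thesis by blast
  qed
  have i1: "inj_on (\<lambda>j::nat. {j, j + 1}) {..n}" by (rule inj_onI) (auto simp: doubleton_eq_iff)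
  have i2: "inj_on (\<lambda>k. {k + 2, lo k}) {..<n}"
  proof (rule inj_onI)
    fix k k' assume "{k + 2, lo k} = {k' + 2, lo k'}"
    then show "k = k'" using lo_le[of k] lo_le[of k'] by (auto simp: doubleton_eq_iff)
  qed
  have g: "?g (v ` {i,j}) = \<theta> (d i) (d j)" if "i \<le> n + 1" "j \<le> n + 1" for i j
    using symmetric_Min_Max_doubleton[of \<theta>, OF sym, where f = "deg ts" and p = "v i" and q = "v j"] deg_v that by simp
  have "TI \<theta> ts = (\<Sum>e\<in>?E1 \<union> ?E2. ?g (v ` e))"
    unfolding TI_def fig_edges_eq by (simp only: sum.reindex[OF injv] o_def)
  also have "\<dots> = (\<Sum>e\<in>?E1. ?g (v ` e)) + (\<Sum>e\<in>?E2. ?g (v ` e))"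
    using disj by (intro sum.union_disjoint) auto
  also have "(\<Sum>e\<in>?E1. ?g (v ` e)) = (\<Sum>j\<le>n. ?g (v ` {j, j + 1}))"
    by (simp only: sum.reindex[OF i1] o_def)
  also have "\<dots> = (\<Sum>j\<le>n. \<theta> (d j) (d (j + 1)))"
    by (intro sum.cong refl g) auto
  also have "(\<Sum>e\<in>?E2. ?g (v ` e)) = (\<Sum>k<n. ?g (v ` {k + 2, lo k}))"
    by (simp only: sum.reindex[OF i2] o_def)
  also have "\<dots> = (\<Sum>k<n. \<theta> (d (k + 2)) (d (lo k)))"
  proof (intro sum.cong refl g)
    show "k + 2 \<le> n + 1" "lo k \<le> n + 1" if "k \<in> {..<n}" for k using that lo_le[of k] by auto
  qed
  finally show ?thesis .
qed

definition turn :: "nat \<Rightarrow> real" where "turn k = (if k \<in> Q then 1 else 0)"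

lemma turn_outside: "k < 3 \<Longrightarrow> turn k = 0" "n \<le> k \<Longrightarrow> turn k = 0"
  using Q_bounds by (force simp: turn_def)+

text \<open>A polynomial in 0/1 indicators can be summed termwise. The two degrees depend on the
  turns among \<open>j\<close>, \<open>j + 1\<close>, \<open>j + 2\<close> only; neighbouring ones
  exclude each other, so a single product survives.\<close>

lemma first_interior:
  fixes \<theta> :: "nat \<Rightarrow> nat \<Rightarrow> real"
  assumes sym: "\<And>a b. \<theta> a b = \<theta> b a" and j: "2 \<le> j" "j \<le> n - 2"
  shows "\<theta> (d j) (d (j + 1)) = \<theta> 4 4 + turn (j + 1) * (\<theta> 3 5 - \<theta> 4 4) + turn j * (\<theta> 3 4 - \<theta> 4 4)
    + turn (j + 2) * (\<theta> 4 5 - \<theta> 4 4) + turn j * turn (j + 2) * (\<theta> 3 5 - \<theta> 3 4 - \<theta> 4 5 + \<theta> 4 4)"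
  using assms(2-) n4 Q_gap[of j] Q_gap[of "Suc j"] sym[of 5 3]
  by (auto simp: d_def turn_def)

lemma second_interior:
  fixes \<theta> :: "nat \<Rightarrow> nat \<Rightarrow> real"
  assumes sym: "\<And>a b. \<theta> a b = \<theta> b a" and k: "2 \<le> k" "k \<le> n - 3"
  shows "\<theta> (d (k + 2)) (d (lo k)) = \<theta> 4 4 + (turn k + turn (k + 1) + turn (k + 3)) * (\<theta> 4 5 - \<theta> 4 4)
    + turn (k + 2) * (\<theta> 3 4 - \<theta> 4 4)
    + turn k * turn (k + 2) * (\<theta> 3 5 - \<theta> 3 4 - \<theta> 4 5 + \<theta> 4 4)
    + (turn k * turn (k + 3) + turn (k + 1) * turn (k + 3)) * (\<theta> 5 5 - 2 * \<theta> 4 5 + \<theta> 4 4)"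
proof -
  have gaps: "k \<in> Q \<Longrightarrow> k + 1 \<notin> Q" "k + 1 \<in> Q \<Longrightarrow> k + 2 \<notin> Q" "k + 2 \<in> Q \<Longrightarrow> k + 3 \<notin> Q"
    using Q_gap[of k] Q_gap[of "k + 1"] Q_gap[of "k + 2"] by (auto simp: eval_nat_numeral)
  have "d (k + 2) = (if k + 3 \<in> Q then 5 else if k + 2 \<in> Q then 3 else 4)"
  proof -
    have "k + 2 < n" using k n4 by linarith
    then show ?thesis by (simp add: d_def numeral_3_eq_3)
  qed
  \<comment> \<open>Degree 3 does not occur: if \<open>k\<close> is a turn, \<open>lo k\<close> is
    not \<open>k\<close> but the centre \<open>k - 1\<close> of the fan.\<close>
  moreover have "d (lo k) = (if k \<in> Q \<or> k + 1 \<in> Q then 5 else 4)"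
    using k n4 Q_bounds[of k] gaps(1) by (auto simp: d_def lo_def)
  ultimately show ?thesis
    using gaps sym[of 5 4]
    by (cases "k \<in> Q"; cases "k + 1 \<in> Q"; cases "k + 2 \<in> Q"; cases "k + 3 \<in> Q")
       (simp_all add: turn_def)
qed

section \<open>Boundary terms and the closed form\<close>

lemma d_low:
  "d 0 = 2" "d 1 = 3" "d 2 = 4 + (if 3 \<in> Q then 1 else 0)"
  "d 3 = (if 3 \<in> Q then 3 else if 4 \<in> Q then 5 else 4)"
proof -
  have "2 \<notin> Q" using Q_bounds by force
  then show "d 2 = 4 + (if 3 \<in> Q then 1 else 0)" using n4 by (simp add: d_def)
  have "3 \<in> Q \<Longrightarrow> 4 \<notin> Q" using Q_gap[of 3] by simp
  then show "d 3 = (if 3 \<in> Q then 3 else if 4 \<in> Q then 5 else 4)" using n4 by (simp add: d_def)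
qed (use n4 in \<open>simp_all add: d_def\<close>)

lemma d_mid: "2 \<le> j \<Longrightarrow> j < n \<Longrightarrow> d j = (if Suc j \<in> Q then 5 else if j \<in> Q then 3 else 4)"
  by (simp add: d_def)

lemma d_high:
  "d (n + 1) = 2" "d n = 3" "d (n - 1) = 4 - (if n - 1 \<in> Q then 1 else 0)"
  "d (lo (n - 1)) = 4 + (if n - 1 \<in> Q then 1 else 0)"
  "d (lo (n - 2)) = (if n - 1 \<in> Q \<or> n - 2 \<in> Q then 5 else 4)"
proof -
  have nQ: "n \<notin> Q" using Q_bounds by force
  have Suc_eqs: "Suc (n - 1) = n" "Suc (n - 2) = n - 1" "Suc (n - 3) = n - 2" "n - 1 - 1 = n - 2" "n - 2 - 1 = n - 3"
    using n4 by auto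
  show "d (n - 1) = 4 - (if n - 1 \<in> Q then 1 else 0)"
    using d_mid[of "n - 1"] nQ n4 unfolding Suc_eqs(1) by simp
  show "d (lo (n - 1)) = 4 + (if n - 1 \<in> Q then 1 else 0)"
  proof (cases "n - 1 \<in> Q")
    case True
    then have "lo (n - 1) = n - 2" using Suc_eqs(4) by (simp add: lo_def)
    moreover have "d (n - 2) = 5" using d_mid[of "n - 2"] True n4 unfolding Suc_eqs(2) by simp
    ultimately show ?thesis using True by simp
  next
    case False
    then show ?thesis using d_mid[of "n - 1"] nQ n4 unfolding Suc_eqs(1) by (simp add: lo_def)
  qed
  show "d (lo (n - 2)) = (if n - 1 \<in> Q \<or> n - 2 \<in> Q then 5 else 4)"
  proof (cases "n - 2 \<in> Q")
    case True
    then have "lo (n - 2) = n - 3" using Suc_eqs(5) by (simp add: lo_def)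
    moreover have "d (n - 3) = 5"
    proof -
      have "2 \<le> n - 3" "n - 3 < n" using Q_bounds[OF True] by linarith+
      then show ?thesis using d_mid[of "n - 3"] True unfolding Suc_eqs(3) by simp
    qed
    ultimately show ?thesis using True by simp
  next
    case False
    then show ?thesis using d_mid[of "n - 2"] n4 unfolding Suc_eqs(2) by (simp add: lo_def)
  qed
qed (use n4 in \<open>simp_all add: d_def\<close>)

lemma sum_first:
  fixes \<theta> :: "nat \<Rightarrow> nat \<Rightarrow> real"
  shows "(\<Sum>j\<le>n. \<theta> (d j) (d (j + 1))) = \<theta> 2 3 + \<theta> 3 (4 + (if 3 \<in> Q then 1 else 0))
    + (\<Sum>j\<in>{2..n-2}. \<theta> (d j) (d (j + 1))) + \<theta> (4 - (if n - 1 \<in> Q then 1 else 0)) 3 + \<theta> 3 2"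
proof -
  obtain m where m: "n = m + 4" using n4 by (metis add.commute le_Suc_ex)
  have "{..n} = {0,1} \<union> {2..n-2} \<union> {n-1,n}" using m by auto
  then have "(\<Sum>j\<le>n. \<theta> (d j) (d (j + 1))) =
     (\<Sum>j\<in>{0,1} \<union> {2..n-2} \<union> {n-1,n}. \<theta> (d j) (d (j + 1)))" by simp
  also have "\<dots> = (\<Sum>j\<in>{0,1}. \<theta> (d j) (d (j + 1))) + (\<Sum>j\<in>{2..n-2}. \<theta> (d j) (d (j + 1)))
      + (\<Sum>j\<in>{n-1,n}. \<theta> (d j) (d (j + 1)))"
    using m by (subst sum.union_disjoint; (subst sum.union_disjoint)?) auto
  also have "(\<Sum>j\<in>{0,1}. \<theta> (d j) (d (j + 1))) = \<theta> 2 3 + \<theta> 3 (4 + (if 3 \<in> Q then 1 else 0))"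
    using d_low by (simp add: numeral_2_eq_2[symmetric])
  also have "(\<Sum>j\<in>{n-1,n}. \<theta> (d j) (d (j + 1))) = \<theta> (4 - (if n - 1 \<in> Q then 1 else 0)) 3 + \<theta> 3 2"
    using d_high n4 by simp
  finally show ?thesis by simp
qed

lemma sum_second:
  fixes \<theta> :: "nat \<Rightarrow> nat \<Rightarrow> real"
  shows "(\<Sum>k<n. \<theta> (d (k + 2)) (d (lo k))) =
      \<theta> (4 + (if 3 \<in> Q then 1 else 0)) 2 + \<theta> (if 3 \<in> Q then 3 else if 4 \<in> Q then 5 else 4) 3
    + (\<Sum>k\<in>{2..n-3}. \<theta> (d (k + 2)) (d (lo k)))
    + \<theta> 3 (if n - 1 \<in> Q \<or> n - 2 \<in> Q then 5 else 4) + \<theta> 2 (4 + (if n - 1 \<in> Q then 1 else 0))"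
proof -
  obtain m where m: "n = m + 4" using n4 by (metis add.commute le_Suc_ex)
  have bd: "3 \<le> q \<and> q < m + 4" if "q \<in> Q" for q using Q_bounds[OF that] m by simp
  have notin: "0 \<notin> Q" "Suc 0 \<notin> Q" using bd by force+
  have "{..<n} = {0,1} \<union> {2..n-3} \<union> {n-2,n-1}" using m by auto
  then have "(\<Sum>k<n. \<theta> (d (k + 2)) (d (lo k))) =
     (\<Sum>k\<in>{0,1} \<union> {2..n-3} \<union> {n-2,n-1}. \<theta> (d (k + 2)) (d (lo k)))" by simp
  also have "\<dots> = (\<Sum>k\<in>{0,1}. \<theta> (d (k + 2)) (d (lo k))) + (\<Sum>k\<in>{2..n-3}. \<theta> (d (k + 2)) (d (lo k)))
      + (\<Sum>k\<in>{n-2,n-1}. \<theta> (d (k + 2)) (d (lo k)))"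
    using m by (subst sum.union_disjoint; (subst sum.union_disjoint)?) auto
  also have "(\<Sum>k\<in>{0,1}. \<theta> (d (k + 2)) (d (lo k))) = \<theta> (d 2) (d 0) + \<theta> (d 3) (d 1)"
    using notin by (simp add: lo_def numeral_2_eq_2[symmetric] numeral_3_eq_3[symmetric])
  also have "(\<Sum>k\<in>{n-2,n-1}. \<theta> (d (k + 2)) (d (lo k))) = \<theta> (d n) (d (lo (n - 2))) + \<theta> (d (n + 1)) (d (lo (n - 1)))"
  proof -
    have "n - 2 \<noteq> n - 1" "n - 2 + 2 = n" "n - 1 + 2 = n + 1" using n4 by auto
    then show ?thesis by (simp del: add_2_eq_Suc add_2_eq_Suc')
  qed
  finally show ?thesis by (simp add: d_low[simplified] d_high[simplified])
qed

lemma TI_closed_form: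
  fixes \<theta> :: "nat \<Rightarrow> nat \<Rightarrow> real"
  assumes sym: "\<And>a b. \<theta> a b = \<theta> b a"
  shows "TI \<theta> ts = Lam0 \<theta> n + Lam1 \<theta> * (turn 3 + turn (n - 1)) + Lam2 \<theta> * (turn 4 + turn (n - 2))
    + (1 + (\<Sum>k\<in>{3..<n}. turn k)) * Lam3 \<theta>
    + Lam4 \<theta> * (\<Sum>k\<in>{3..<n}. turn k * turn (k + 2)) + Lam5 \<theta> * (\<Sum>k\<in>{3..<n}. turn k * turn (k + 3))"
proof -
  obtain m where m: "n = m + 4" using n4 by (metis add.commute le_Suc_ex)
  define N where "N = (\<Sum>k\<in>{3..<n}. turn k)"
  define B where "B = (\<Sum>k\<in>{3..<n}. turn k * turn (k + 2))"
  define C where "C = (\<Sum>k\<in>{3..<n}. turn k * turn (k + 3))"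
  have x0: "turn 2 = 0" "turn (m + 4) = 0" "turn (m + 5) = 0" "turn (m + 6) = 0" using turn_outside m by auto
  have ivl: "{3..<n} = {3..m+3}" using m by auto
  have sh: "(\<Sum>k\<in>{a..b}. f (k + c)) = (\<Sum>k\<in>{a+c..b+c}. f k)" for a b c :: nat and f :: "nat \<Rightarrow> real"
    by (rule sum.shift_bounds_cl_nat_ivl[symmetric])
  have lo2: "(\<Sum>k\<in>{2..m+3}. f k) = f 2 + (\<Sum>k\<in>{3..m+3}. f k)" for f :: "nat \<Rightarrow> real"
    using sum.atLeast_Suc_atMost[of 2 "m + 3" f] by simp
  have lo3: "(\<Sum>k\<in>{3..m+3}. f k) = f 3 + (\<Sum>k\<in>{4..m+3}. f k)" for f :: "nat \<Rightarrow> real"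
    using sum.atLeast_Suc_atMost[of 3 "m + 3" f] by simp
  have lo4: "(\<Sum>k\<in>{4..m+4}. f k) = f 4 + (\<Sum>k\<in>{5..m+4}. f k)" for f :: "nat \<Rightarrow> real"
    using sum.atLeast_Suc_atMost[of 4 "m + 4" f] by simp
  have hi4: "(\<Sum>k\<in>{4..m+4}. f k) = (\<Sum>k\<in>{4..m+3}. f k) + f (m + 4)" for f :: "nat \<Rightarrow> real"
    by (simp add: eval_nat_numeral)
  have hi3: "(\<Sum>k\<in>{2..m+3}. f k) = (\<Sum>k\<in>{2..m+2}. f k) + f (m + 3)"
    "(\<Sum>k\<in>{3..m+3}. f k) = (\<Sum>k\<in>{3..m+2}. f k) + f (m + 3)" for f :: "nat \<Rightarrow> real"
    by (simp_all add: eval_nat_numeral)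
  have hi2: "(\<Sum>k\<in>{2..m+2}. f k) = (\<Sum>k\<in>{2..m+1}. f k) + f (m + 2)" for f :: "nat \<Rightarrow> real"
    using sum.nat_ivl_Suc'[of 2 "m + 1" f] by (simp add: add.commute)
  \<comment> \<open>Shifted sums of \<open>turn\<close> differ from the number \<open>N\<close> of
    turns only by those pushed out of the window; the differences enter \<open>Lam1\<close> and
    \<open>Lam2\<close>.\<close>
  have s: "(\<Sum>j\<in>{2..m+2}. turn j) = N - turn (m + 3)" "(\<Sum>j\<in>{2..m+2}. turn (j + 1)) = N"
    "(\<Sum>j\<in>{2..m+2}. turn (j + 2)) = N - turn 3"
    "(\<Sum>j\<in>{2..m+1}. turn j) = N - turn (m + 2) - turn (m + 3)" "(\<Sum>j\<in>{2..m+1}. turn (j + 1)) = N - turn (m + 3)"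
    "(\<Sum>j\<in>{2..m+1}. turn (j + 2)) = N - turn 3" "(\<Sum>j\<in>{2..m+1}. turn (j + 3)) = N - turn 3 - turn 4"
  proof -
    have "(\<Sum>j\<in>{2..m+2}. turn (j + 1)) = (\<Sum>k\<in>{3..m+3}. turn k)"
      "(\<Sum>j\<in>{2..m+2}. turn (j + 2)) = (\<Sum>k\<in>{4..m+4}. turn k)"
      "(\<Sum>j\<in>{2..m+1}. turn (j + 1)) = (\<Sum>k\<in>{3..m+2}. turn k)"
      "(\<Sum>j\<in>{2..m+1}. turn (j + 2)) = (\<Sum>k\<in>{4..m+3}. turn k)"
      "(\<Sum>j\<in>{2..m+1}. turn (j + 3)) = (\<Sum>k\<in>{5..m+4}. turn k)"
      by (subst sh; simp add: eval_nat_numeral)+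
    then show "(\<Sum>j\<in>{2..m+2}. turn j) = N - turn (m + 3)" "(\<Sum>j\<in>{2..m+2}. turn (j + 1)) = N"
      "(\<Sum>j\<in>{2..m+2}. turn (j + 2)) = N - turn 3"
      "(\<Sum>j\<in>{2..m+1}. turn j) = N - turn (m + 2) - turn (m + 3)" "(\<Sum>j\<in>{2..m+1}. turn (j + 1)) = N - turn (m + 3)"
      "(\<Sum>j\<in>{2..m+1}. turn (j + 2)) = N - turn 3" "(\<Sum>j\<in>{2..m+1}. turn (j + 3)) = N - turn 3 - turn 4"
      using lo2[of turn] lo3[of turn] lo4[of turn] hi4[of turn] hi3[of turn] hi2[of turn] x0
      unfolding N_def ivl by linarith+
  qed
  let ?b = "\<lambda>k. turn k * turn (k + 2)" and ?c = "\<lambda>k. turn k * turn (k + 3)"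
  have b0: "?b 2 = 0" "?b (m + 2) = 0" "?b (m + 3) = 0" "?c 2 = 0" "?c (m + 2) = 0" "?c (m + 3) = 0"
    using x0 turn_outside(2) m by auto
  have p: "(\<Sum>j\<in>{2..m+2}. turn j * turn (j + 2)) = B" "(\<Sum>j\<in>{2..m+1}. turn j * turn (j + 2)) = B"
    "(\<Sum>j\<in>{2..m+1}. turn j * turn (j + 3)) = C"
    using lo2[of ?b] lo2[of ?c] hi3[of ?b] hi3[of ?c] hi2[of ?b] hi2[of ?c] b0
    unfolding B_def C_def ivl by linarith+
  \<comment> \<open>Here the two indices are again 2 apart, so the sum is \<open>B\<close>. This is
    how \<open>Lam5\<close> becomes a summand of \<open>Lam4\<close>.\<close>
  have p': "(\<Sum>j\<in>{2..m+1}. turn (j + 1) * turn (j + 3)) = B"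
  proof -
    have "(\<Sum>j\<in>{2..m+1}. turn (j + 1) * turn (j + 3)) = (\<Sum>j\<in>{2..m+1}. ?b (j + 1))"
      by (simp add: eval_nat_numeral)
    also have "\<dots> = (\<Sum>j\<in>{3..m+2}. ?b j)" using sh[of ?b 1 2 "m + 1"] by simp
    also have "\<dots> = B" using hi3(2)[of ?b] b0 unfolding B_def ivl by linarith
    finally show ?thesis .
  qed
  have "(\<Sum>j\<in>{2..n-2}. \<theta> (d j) (d (j + 1))) = (\<Sum>j\<in>{2..m+2}. \<theta> 4 4 + turn (j + 1) * (\<theta> 3 5 - \<theta> 4 4)
    + turn j * (\<theta> 3 4 - \<theta> 4 4) + turn (j + 2) * (\<theta> 4 5 - \<theta> 4 4)
    + turn j * turn (j + 2) * (\<theta> 3 5 - \<theta> 3 4 - \<theta> 4 5 + \<theta> 4 4))"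
    using first_interior[OF sym] m by (intro sum.cong) auto
  also have "\<dots> = real (m + 1) * \<theta> 4 4 + N * (\<theta> 3 5 - \<theta> 4 4) + (N - turn (m + 3)) * (\<theta> 3 4 - \<theta> 4 4)
    + (N - turn 3) * (\<theta> 4 5 - \<theta> 4 4) + B * (\<theta> 3 5 - \<theta> 3 4 - \<theta> 4 5 + \<theta> 4 4)"
    by (simp only: sum.distrib sum_distrib_right[symmetric] s p sum_constant card_atLeastAtMost) simp
  finally have first: "(\<Sum>j\<in>{2..n-2}. \<theta> (d j) (d (j + 1))) = real (m + 1) * \<theta> 4 4 + N * (\<theta> 3 5 - \<theta> 4 4)
    + (N - turn (m + 3)) * (\<theta> 3 4 - \<theta> 4 4)
    + (N - turn 3) * (\<theta> 4 5 - \<theta> 4 4) + B * (\<theta> 3 5 - \<theta> 3 4 - \<theta> 4 5 + \<theta> 4 4)" .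
  have "(\<Sum>k\<in>{2..n-3}. \<theta> (d (k + 2)) (d (lo k))) = (\<Sum>k\<in>{2..m+1}. \<theta> 4 4
    + (turn k + turn (k + 1) + turn (k + 3)) * (\<theta> 4 5 - \<theta> 4 4) + turn (k + 2) * (\<theta> 3 4 - \<theta> 4 4)
    + turn k * turn (k + 2) * (\<theta> 3 5 - \<theta> 3 4 - \<theta> 4 5 + \<theta> 4 4)
    + (turn k * turn (k + 3) + turn (k + 1) * turn (k + 3)) * (\<theta> 5 5 - 2 * \<theta> 4 5 + \<theta> 4 4))"
    using second_interior[OF sym] m by (intro sum.cong) auto
  also have "\<dots> = real m * \<theta> 4 4
    + ((N - turn (m + 2) - turn (m + 3)) + (N - turn (m + 3)) + (N - turn 3 - turn 4)) * (\<theta> 4 5 - \<theta> 4 4)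
    + (N - turn 3) * (\<theta> 3 4 - \<theta> 4 4) + B * (\<theta> 3 5 - \<theta> 3 4 - \<theta> 4 5 + \<theta> 4 4)
    + (C + B) * (\<theta> 5 5 - 2 * \<theta> 4 5 + \<theta> 4 4)"
    by (simp only: sum.distrib sum_distrib_right[symmetric] s p p' sum_constant card_atLeastAtMost) simp
  finally have second: "(\<Sum>k\<in>{2..n-3}. \<theta> (d (k + 2)) (d (lo k))) = real m * \<theta> 4 4
    + ((N - turn (m + 2) - turn (m + 3)) + (N - turn (m + 3)) + (N - turn 3 - turn 4)) * (\<theta> 4 5 - \<theta> 4 4)
    + (N - turn 3) * (\<theta> 3 4 - \<theta> 4 4) + B * (\<theta> 3 5 - \<theta> 3 4 - \<theta> 4 5 + \<theta> 4 4)
    + (C + B) * (\<theta> 5 5 - 2 * \<theta> 4 5 + \<theta> 4 4)" .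
  have gap: "m + 2 \<in> Q \<Longrightarrow> m + 3 \<notin> Q" "3 \<in> Q \<Longrightarrow> 4 \<notin> Q"
    using Q_gap[of "m + 2"] Q_gap[of 3] by (auto simp: eval_nat_numeral)
  have nm: "n - 1 = m + 3" "n - 2 = m + 2" using m by auto
  have ends: "\<theta> 3 (4 + (if 3 \<in> Q then 1 else 0)) = \<theta> 3 4 + turn 3 * (\<theta> 3 5 - \<theta> 3 4)"
    "\<theta> (4 - (if m + 3 \<in> Q then 1 else 0)) 3 = \<theta> 3 4 + turn (m + 3) * (\<theta> 3 3 - \<theta> 3 4)"
    "\<theta> (4 + (if 3 \<in> Q then 1 else 0)) 2 = \<theta> 2 4 + turn 3 * (\<theta> 2 5 - \<theta> 2 4)"
    "\<theta> (if 3 \<in> Q then 3 else if 4 \<in> Q then 5 else 4) 3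
       = \<theta> 3 4 + turn 3 * (\<theta> 3 3 - \<theta> 3 4) + turn 4 * (\<theta> 3 5 - \<theta> 3 4)"
    "\<theta> 3 (if m + 3 \<in> Q \<or> m + 2 \<in> Q then 5 else 4) = \<theta> 3 4 + (turn (m + 2) + turn (m + 3)) * (\<theta> 3 5 - \<theta> 3 4)"
    "\<theta> 2 (4 + (if m + 3 \<in> Q then 1 else 0)) = \<theta> 2 4 + turn (m + 3) * (\<theta> 2 5 - \<theta> 2 4)"
    "\<theta> 3 2 = \<theta> 2 3"
    using gap sym[of 4 3] sym[of 4 2] sym[of 5 2] sym[of 5 3] sym[of 3 2] by (auto simp: turn_def)
  have "real n = real m + 4" using m by simp
  then show ?thesis
    unfolding TI_eq_sums[OF sym] sum_first[of \<theta>] sum_second[of \<theta>] first second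
    unfolding Lam0_def Lam1_def Lam2_def Lam3_def Lam4_def Lam5_def N_def[symmetric] B_def[symmetric] C_def[symmetric] nm ends
    by (simp add: algebra_simps)
qed

section \<open>Segments\<close>

text \<open>Only the centre \<open>v (q - 1)\<close> of a fan \<open>q - 3, ..., q\<close> lies in
  four triangles, so a piece is linear unless it contains a whole fan.\<close>

lemma lin_piece_Q: "lin_piece ts i j \<longleftrightarrow> i \<le> j \<and> j < n \<and> (\<forall>q\<in>Q. i + 3 \<le> q \<longrightarrow> j < q)"
proof (cases "i \<le> j \<and> j < n")
  case True
  have "(\<forall>u. card {k \<in> {i..j}. u \<in> ts ! k} \<le> 3) \<longleftrightarrow> (\<forall>q\<in>Q. i + 3 \<le> q \<longrightarrow> j < q)"
  proof
    assume le3: "\<forall>u. card {k \<in> {i..j}. u \<in> ts ! k} \<le> 3"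
    show "\<forall>q\<in>Q. i + 3 \<le> q \<longrightarrow> j < q"
    proof (intro ballI impI, rule ccontr)
      fix q assume q: "q \<in> Q" "i + 3 \<le> q" "\<not> j < q"
      have b: "3 \<le> q" "q < n" using Q_bounds[OF q(1)] by auto
      have "v (q - 1) \<in> ts ! k" if k: "k \<in> {q-3..q}" for k
      proof -
        have "q - 1 = k + 2 \<or> q - 1 = k + 1 \<or> k = q - 1 \<or> k = q" using k b by auto
        then have "q - 1 = k + 2 \<or> q - 1 = k + 1 \<or> q - 1 = lo k"
          using lo_lo_pred[OF q(1)] q(1) lo_def[of q] by auto
        then show ?thesis using v_mem_iff[of "q - 1" k] k b by auto
      qed
      then have "{q-3..q} \<subseteq> {k \<in> {i..j}. v (q - 1) \<in> ts ! k}" using q by auto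
      then have "card {q-3..q} \<le> card {k \<in> {i..j}. v (q - 1) \<in> ts ! k}" by (intro card_mono) auto
      moreover have "card {q-3..q} = 4" using b by simp
      ultimately show False using le3[rule_format, of "v (q - 1)"] by simp
    qed
  next
    assume none: "\<forall>q\<in>Q. i + 3 \<le> q \<longrightarrow> j < q"
    show "\<forall>u. card {k \<in> {i..j}. u \<in> ts ! k} \<le> 3"
    proof (intro allI, rule ccontr)
      fix u assume c: "\<not> card {k \<in> {i..j}. u \<in> ts ! k} \<le> 3"
      let ?S = "{k \<in> {i..j}. u \<in> ts ! k}"
      have "?S \<noteq> {}" using c by (metis card.empty zero_le)
      then have "u \<in> fig_verts ts" using True len by (auto simp: fig_verts_def)
      then obtain l where l: "u = v l" "l \<le> n + 1" by (auto simp: fig_verts_eq)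
      have S: "?S = {k \<in> {i..j}. l = lo k \<or> l = k + 1 \<or> l = k + 2}"
        using v_mem_iff[OF l(2)] l(1) True by auto
      have S4: "?S \<subseteq> {l - 2, l - 1, l, l + 1}"
        unfolding S lo_def by auto
      \<comment> \<open>Triangle \<open>l + 1\<close> contains \<open>v l\<close> only if it is a
        turn; without it three candidates remain.\<close>
      have q: "Suc l \<in> Q"
      proof (rule ccontr)
        assume nq: "Suc l \<notin> Q"
        have "?S \<subseteq> {l - 2, l - 1, l}"
        proof
          fix k assume k: "k \<in> ?S"
          then have "k \<noteq> l + 1" using nq unfolding S lo_def by (auto split: if_splits)
          then show "k \<in> {l - 2, l - 1, l}" using S4 k by blast
        qed
        then have "card ?S \<le> card {l - 2, l - 1, l}" by (intro card_mono) auto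
        also have "\<dots> \<le> 3" by (simp add: card_insert_if)
        finally show False using c by simp
      qed
      have l2: "2 \<le> l" using Q_bounds[OF q] by simp
      have eq: "?S = {l - 2, l - 1, l, l + 1}"
      proof (rule card_seteq[OF _ S4])
        show "card {l - 2, l - 1, l, l + 1} \<le> card ?S" 
        proof -
          have "card {l - 2, l - 1, l, l + 1} \<le> 4" by (intro card_insert_le_m1) auto
          then show ?thesis using c by linarith
        qed
      qed simp
      have "l - 2 \<in> ?S" "l + 1 \<in> ?S" unfolding eq by simp_all
      then have "i + 3 \<le> Suc l" "Suc l \<le> j" using l2 by auto
      then show False using none q by auto
    qed
  qed
  then show ?thesis unfolding lin_piece_iff[OF chain] len by simp
qed (auto simp: lin_piece_iff[OF chain] len)

text \<open>Adding one triangle on the left fails only by completing the fan of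
  \<open>q = i + 2\<close>, on the right only that of \<open>q = Suc j\<close>. The bound
  \<open>i + 2 \<le> j\<close> says that this fan fits into the extended piece.\<close>

lemma segment_Q:
  "segment ts i j \<longleftrightarrow> i \<le> j \<and> j < n \<and> (\<forall>q\<in>Q. i + 3 \<le> q \<longrightarrow> j < q)
     \<and> (i = 0 \<or> i + 2 \<in> Q \<and> i + 2 \<le> j) \<and> (Suc j = n \<or> Suc j \<in> Q \<and> i + 2 \<le> j)" (is "?L \<longleftrightarrow> ?R")
proof
  assume seg: ?L
  then have lp: "lin_piece ts i j" and
    mx: "\<And>i' j'. lin_piece ts i' j' \<Longrightarrow> i' \<le> i \<Longrightarrow> j \<le> j' \<Longrightarrow> i' = i \<and> j' = j"
    unfolding segment_def by blast+
  have a: "i \<le> j" "j < n" "\<And>q. q \<in> Q \<Longrightarrow> i + 3 \<le> q \<Longrightarrow> j < q" using lp lin_piece_Q by auto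
  have "i + 2 \<in> Q \<and> i + 2 \<le> j" if "i \<noteq> 0"
  proof -
    have "\<not> lin_piece ts (i - 1) j" using mx[of "i - 1" j] that by auto
    then obtain q where q: "q \<in> Q" "i - 1 + 3 \<le> q" "q \<le> j" using a lin_piece_Q by (auto simp: not_less)
    then have "q = i + 2" using a(3)[of q] that by linarith
    then show ?thesis using q by simp
  qed
  moreover have "Suc j \<in> Q \<and> i + 2 \<le> j" if "Suc j \<noteq> n"
  proof -
    have "\<not> lin_piece ts i (Suc j)" using mx[of i "Suc j"] by auto
    moreover have "Suc j < n" using that a(2) by simp
    ultimately obtain q where q: "q \<in> Q" "i + 3 \<le> q" "q \<le> Suc j" using a lin_piece_Q by (auto simp: not_less)
    then have "q = Suc j" using a(3)[of q] by linarith
    then show ?thesis using q by simp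
  qed
  ultimately show ?R using a by blast
next
  assume R: ?R
  have "i' = i \<and> j' = j" if "lin_piece ts i' j'" "i' \<le> i" "j \<le> j'" for i' j'
  proof (rule ccontr)
    assume "\<not> (i' = i \<and> j' = j)"
    have l: "j' < n" "\<And>q. q \<in> Q \<Longrightarrow> i' + 3 \<le> q \<Longrightarrow> j' < q" using that(1) lin_piece_Q by auto
    show False
    proof (cases "i' = i")
      case True
      then have "j < j'" using \<open>\<not> (i' = i \<and> j' = j)\<close> that by auto
      then show False using R l(1) l(2)[of "Suc j"] that by auto
    next
      case False
      then show False using R l(2)[of "i + 2"] that by auto
    qed
  qed
  then show ?L unfolding segment_def lin_piece_Q using R by (auto simp: lin_piece_Q)
qed

section \<open>Enumeration of the segments\<close>

definition turns :: "nat list" where "turns = sorted_list_of_set Q"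

text \<open>Segment \<open>m\<close>, counted from 0, lies between the turns with positions
  \<open>m - 1\<close> and \<open>m\<close> in \<open>turns\<close>; the ends of the chain replace
  the missing turns.\<close>

definition seg_start :: "nat \<Rightarrow> nat" where "seg_start m = (if m = 0 then 0 else turns ! (m - 1) - 2)"

definition seg_end :: "nat \<Rightarrow> nat" where "seg_end m = (if m < length turns then turns ! m - 1 else n - 1)"

lemma finite_Q: "finite Q" using Q_sub finite_subset by blast

lemma set_turns: "set turns = Q" using finite_Q by (simp add: turns_def)

lemma turns_mem: "m < length turns \<Longrightarrow> turns ! m \<in> Q" using set_turns by force

lemma turns_less: "i < j \<Longrightarrow> j < length turns \<Longrightarrow> turns ! i < turns ! j"
  unfolding turns_def by (simp add: sorted_wrt_nth_less)

lemma turns_gap: "Suc m < length turns \<Longrightarrow> turns ! m + 2 \<le> turns ! Suc m"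
  using turns_less[of m "Suc m"] Q_gap[OF turns_mem[of m]] turns_mem[of "Suc m"]
  by (metis Suc_leI Suc_lessD add_2_eq_Suc' le_neq_implies_less lessI)

text \<open>By sortedness no turn lies strictly between consecutive entries of \<open>turns\<close>;
  for \<open>m = 0\<close> there is no lower bound.\<close>

lemma turns_next:
  assumes "q \<in> Q" "m = 0 \<or> turns ! (m - 1) < q" "m \<le> length turns"
  shows "m < length turns \<and> turns ! m \<le> q"
proof -
  obtain l where l: "l < length turns" "q = turns ! l" using assms(1) set_turns by (metis in_set_conv_nth)
  have "m \<le> l"
  proof (rule ccontr)
    assume "\<not> m \<le> l"
    then have "m \<noteq> 0" "l \<le> m - 1" "m - 1 < length turns" using assms(3) by auto
    then have "turns ! l \<le> turns ! (m - 1)" using turns_less[of l "m - 1"] by (cases "l = m - 1") auto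
    then show False using assms(2) l \<open>m \<noteq> 0\<close> by auto
  qed
  then show ?thesis using l turns_less[of m l] by (cases "m = l") auto
qed

lemma segments_eq: "{(i,j). segment ts i j} = (\<lambda>m. (seg_start m, seg_end m)) ` {0..<Suc (length turns)}"
proof (intro set_eqI iffI)
  fix p assume "p \<in> {(i,j). segment ts i j}"
  then obtain i j where p: "p = (i,j)" and s: "segment ts i j" by auto
  then have seg: "i \<le> j" "j < n" "\<And>q. q \<in> Q \<Longrightarrow> i + 3 \<le> q \<Longrightarrow> j < q"
    "i = 0 \<or> i + 2 \<in> Q \<and> i + 2 \<le> j" "Suc j = n \<or> Suc j \<in> Q \<and> i + 2 \<le> j"
    using segment_Q by auto
  obtain m where m: "m \<le> length turns" "i = seg_start m" "m \<noteq> 0 \<Longrightarrow> turns ! (m - 1) = i + 2"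
  proof (cases "i = 0")
    case True
    then show thesis using that[of 0] by (simp add: seg_start_def)
  next
    case False
    then obtain l where "l < length turns" "turns ! l = i + 2" using seg(4) set_turns by (metis in_set_conv_nth)
    then show thesis using that[of "Suc l"] by (simp add: seg_start_def)
  qed
  have "j = seg_end m"
  proof (cases "Suc j = n")
    case True
    have "\<not> m < length turns"
    proof
      assume ml: "m < length turns"
      then have "turns ! m \<in> Q" by (rule turns_mem)
      moreover have "i + 3 \<le> turns ! m"
        using m turns_less[of "m - 1" m] ml Q_bounds[OF \<open>turns ! m \<in> Q\<close>] by (cases "m = 0") (auto simp: seg_start_def)
      ultimately show False using seg(3)[of "turns ! m"] True Q_bounds[of "turns ! m"] by auto
    qed
    then show ?thesis using True by (simp add: seg_end_def)
  next
    case False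
    then have sj: "Suc j \<in> Q" "i + 2 \<le> j" using seg(5) by auto
    have "m < length turns \<and> turns ! m \<le> Suc j" 
    proof (rule turns_next[OF sj(1) _ m(1)])
      show "m = 0 \<or> turns ! (m - 1) < Suc j" using m(3) sj(2) by (cases "m = 0") auto
    qed
    moreover have "i + 3 \<le> turns ! m"
      using m turns_less[of "m - 1" m] calculation Q_bounds[OF turns_mem[of m]] by (cases "m = 0") (auto simp: seg_start_def)
    moreover have "j < turns ! m" using seg(3)[OF turns_mem[of m]] calculation by auto
    ultimately show ?thesis by (auto simp: seg_end_def)
  qed
  then show "p \<in> (\<lambda>m. (seg_start m, seg_end m)) ` {0..<Suc (length turns)}" using p m by auto
next
  fix p assume "p \<in> (\<lambda>m. (seg_start m, seg_end m)) ` {0..<Suc (length turns)}"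
  then obtain m where "m \<in> {0..<Suc (length turns)}" and p: "p = (seg_start m, seg_end m)"
    by (rule imageE)
  then have m: "m \<le> length turns" by simp
  have prev: "turns ! (m - 1) \<in> Q" "3 \<le> turns ! (m - 1)" "turns ! (m - 1) < n" "seg_start m + 2 = turns ! (m - 1)" if "m \<noteq> 0"
  proof -
    show "turns ! (m - 1) \<in> Q" using m that by (intro turns_mem) auto
    then show "3 \<le> turns ! (m - 1)" "turns ! (m - 1) < n" using Q_bounds by auto
    then show "seg_start m + 2 = turns ! (m - 1)" using that by (simp add: seg_start_def)
  qed
  have nxt: "turns ! m \<in> Q" "3 \<le> turns ! m" "turns ! m < n" "Suc (seg_end m) = turns ! m" if "m < length turns"
  proof -
    show "turns ! m \<in> Q" using that by (rule turns_mem)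
    then show "3 \<le> turns ! m" "turns ! m < n" using Q_bounds by auto
    then show "Suc (seg_end m) = turns ! m" using that by (simp add: seg_end_def)
  qed
  have st0: "m = 0 \<Longrightarrow> seg_start m = 0" by (simp add: seg_start_def)
  have en0: "\<not> m < length turns \<Longrightarrow> Suc (seg_end m) = n" using n4 by (simp add: seg_end_def)
  have gap: "seg_start m + 4 \<le> turns ! m" if "m < length turns" "m \<noteq> 0"
    using turns_gap[of "m - 1"] that prev(4) by auto
  have "seg_end m < n" using nxt en0 by (cases "m < length turns") auto
  moreover have ij: "m \<noteq> 0 \<Longrightarrow> seg_start m + 2 \<le> seg_end m" "m < length turns \<Longrightarrow> seg_start m + 2 \<le> seg_end m" "seg_start m \<le> seg_end m"
  proof -
    have a: "seg_start m + 2 \<le> seg_end m" if "m < length turns"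
    proof (cases "m = 0")
      case True
      then show ?thesis using nxt(2,4)[OF that] st0 by linarith
    next
      case False
      then show ?thesis using nxt(4)[OF that] gap[OF that] by linarith
    qed
    have b: "seg_start m + 2 \<le> seg_end m" if "m \<noteq> 0" "\<not> m < length turns"
      using prev(3,4)[OF that(1)] en0[OF that(2)] by linarith
    show "m \<noteq> 0 \<Longrightarrow> seg_start m + 2 \<le> seg_end m" "m < length turns \<Longrightarrow> seg_start m + 2 \<le> seg_end m" using a b by blast+
    then show "seg_start m \<le> seg_end m" using st0 by fastforce
  qed
  moreover have "seg_end m < q" if q: "q \<in> Q" "seg_start m + 3 \<le> q" for q
  proof -
    have "m < length turns \<and> turns ! m \<le> q" using turns_next[OF q(1), of m] m prev(4) q(2) by (cases "m = 0") auto
    then show ?thesis using nxt by auto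
  qed
  moreover have "seg_start m = 0 \<or> seg_start m + 2 \<in> Q \<and> seg_start m + 2 \<le> seg_end m"
    using prev st0 ij by (cases "m = 0") auto
  moreover have "Suc (seg_end m) = n \<or> Suc (seg_end m) \<in> Q \<and> seg_start m + 2 \<le> seg_end m"
    using nxt en0 ij by (cases "m < length turns") auto
  ultimately have "segment ts (seg_start m) (seg_end m)" using segment_Q by blast
  then show "p \<in> {(i,j). segment ts i j}" using p by simp
qed

text \<open>The starting indices increase strictly, so the lexicographic order on pairs is the order
  by \<open>m\<close>.\<close>

lemma length_vector_eq: "length_vector ts = map (\<lambda>m. Suc (seg_end m) - seg_start m) [0..<Suc (length turns)]"
proof -
  let ?xs = "map (\<lambda>m. (seg_start m, seg_end m)) [0..<Suc (length turns)]"
  have seg_start_less: "seg_start i < seg_start j" if "i < j" "j < Suc (length turns)" for i j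
  proof -
    have "3 \<le> turns ! (j - 1)" using Q_bounds[OF turns_mem[of "j - 1"]] that by auto
    moreover have "i \<noteq> 0 \<Longrightarrow> turns ! (i - 1) < turns ! (j - 1)" using turns_less[of "i - 1" "j - 1"] that by auto
    moreover have "i \<noteq> 0 \<Longrightarrow> 3 \<le> turns ! (i - 1)" using Q_bounds[OF turns_mem[of "i - 1"]] that by auto
    ultimately show ?thesis using that by (auto simp: seg_start_def)
  qed
  have "sorted_wrt (<) ?xs"
    unfolding sorted_wrt_iff_nth_less using seg_start_less by (auto simp del: upt_Suc)
  moreover have "sorted_wrt (<) (sorted_list_of_set {(i,j). segment ts i j})" by simp
  moreover have "set ?xs = set (sorted_list_of_set {(i,j). segment ts i j})"
    unfolding segments_eq by (subst set_sorted_list_of_set) (auto simp del: upt_Suc)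
  ultimately have "sorted_list_of_set {(i,j). segment ts i j} = ?xs"
    by (metis strict_sorted_equal)
  then show ?thesis by (simp add: length_vector_def del: upt_Suc)
qed

section \<open>Segment lengths as distances between turns\<close>

lemma turn_turns_add:
  assumes m: "m < length turns" and c: "c = 2 \<or> c = 3"
  shows "turn (turns ! m + c) = (if Suc m < length turns \<and> turns ! Suc m = turns ! m + c then 1 else 0)"
proof -
  \<comment> \<open>A turn between two turns at distance 2 or 3 would be adjacent to one of them, so
    a turn at such a distance is the next one.\<close>
  have "Suc m < length turns \<and> turns ! Suc m = turns ! m + c" if q: "turns ! m + c \<in> Q"
  proof -
    have n: "Suc m < length turns \<and> turns ! Suc m \<le> turns ! m + c"
      using turns_next[OF q, of "Suc m"] m c by auto
    then have "turns ! m + 2 \<le> turns ! Suc m" using turns_gap by blast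
    moreover have "turns ! Suc m \<noteq> turns ! m + 2" if "c = 3"
      using Q_gap[of "turns ! m + 2"] q that n turns_mem[of "Suc m"] by (metis add_Suc_right eval_nat_numeral(3))
    ultimately show ?thesis using n c by fastforce
  qed
  moreover have "turns ! m + c \<in> Q" if "Suc m < length turns \<and> turns ! Suc m = turns ! m + c"
    using that turns_mem[of "Suc m"] by simp
  ultimately have "turns ! m + c \<in> Q \<longleftrightarrow> Suc m < length turns \<and> turns ! Suc m = turns ! m + c" by blast
  then show ?thesis by (simp only: turn_def)
qed

lemma sum_turn_mult: "(\<Sum>k\<in>{3..<n}. turn k * f k) = (\<Sum>m<length turns. f (turns ! m))"
proof -
  have "(\<Sum>k\<in>{3..<n}. turn k * f k) = (\<Sum>k\<in>Q. f k)"
    using Q_sub by (intro sum.mono_neutral_cong_right) (auto simp: turn_def)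
  also have "\<dots> = sum_list (map f turns)"
    using sum_list_distinct_conv_sum_set[of turns f] set_turns by (simp add: turns_def)
  also have "\<dots> = (\<Sum>m<length turns. f (turns ! m))"
    by (simp add: sum_list_sum_nth atLeast0LessThan)
  finally show ?thesis .
qed

lemma sum_interior_lengths:
  assumes N: "length turns \<noteq> 0" and c: "c = 2 \<or> c = 3"
  shows "(\<Sum>i=2..length turns. ind (c + 2) (length_vector ts ! (i - 1))) = (\<Sum>k\<in>{3..<n}. turn k * turn (k + c))"
proof -
  obtain M where M: "length turns = Suc M" using N by (cases "length turns") auto
  have "(\<Sum>k\<in>{3..<n}. turn k * turn (k + c)) = (\<Sum>m<Suc M. turn (turns ! m + c))"
    using sum_turn_mult[of "\<lambda>k. turn (k + c)"] M by simp
  \<comment> \<open>The last turn has no successor, so its term is 0.\<close>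
  also have "\<dots> = (\<Sum>m<M. turn (turns ! m + c))" using turn_turns_add[of M c] c M by simp
  \<comment> \<open>Counted from 1, the segment between the turns at positions \<open>m\<close> and
    \<open>m + 1\<close> has number \<open>m + 2\<close>.\<close>
  also have "\<dots> = (\<Sum>m\<in>{0..<M}. ind (c + 2) (length_vector ts ! (m + 2 - 1)))"
  proof (intro sum.cong)
    fix m assume "m \<in> {0..<M}"
    then have m: "Suc m < length turns" using M by simp
    have "length_vector ts ! (m + 2 - 1) = Suc (seg_end (Suc m)) - seg_start (Suc m)"
      unfolding length_vector_eq using m by (simp del: upt_Suc)
    also have "\<dots> = turns ! Suc m + 2 - turns ! m"
      using m Q_bounds[OF turns_mem[of "Suc m"]] Q_bounds[OF turns_mem[of m]] by (auto simp: seg_end_def seg_start_def)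
    finally have "length_vector ts ! (m + 2 - 1) = c + 2 \<longleftrightarrow> turns ! Suc m = turns ! m + c"
      using turns_gap[OF m] by auto
    then show "turn (turns ! m + c) = ind (c + 2) (length_vector ts ! (m + 2 - 1))"
      using turn_turns_add[of m c] c m by (simp add: ind_def)
  qed auto
  also have "\<dots> = (\<Sum>i\<in>{0+2..<M+2}. ind (c + 2) (length_vector ts ! (i - 1)))"
    by (rule sum.shift_bounds_nat_ivl[symmetric])
  also have "{0+2..<M+2} = {2..length turns}" using M by auto
  finally show ?thesis by simp
qed

text \<open>The length is the index of the first turn. As 3 and 4 are not both turns, 4 is the first
  one as soon as it is a turn.\<close>

lemma first_length:
  assumes N: "length turns \<noteq> 0"
  shows "ind 3 (length_vector ts ! 0) = turn 3" "ind 4 (length_vector ts ! 0) = turn 4"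
proof -
  have q: "3 \<le> turns ! 0" "turns ! 0 \<in> Q" using Q_bounds[OF turns_mem[of 0]] turns_mem[of 0] N by auto
  have l: "length_vector ts ! 0 = turns ! 0"
    unfolding length_vector_eq using N q by (simp add: seg_end_def seg_start_def del: upt_Suc)
  have le: "turns ! 0 \<le> k" if "k \<in> Q" for k using turns_next[OF that, of 0] by simp
  show "ind 3 (length_vector ts ! 0) = turn 3" using q le[of 3] by (auto simp: l ind_def turn_def)
  have "4 \<in> Q \<Longrightarrow> 3 \<notin> Q" using Q_gap[of 3] by auto
  then show "ind 4 (length_vector ts ! 0) = turn 4" using q le[of 4]
    by (cases "turns ! 0 = 3") (auto simp: l ind_def turn_def)
qed

text \<open>The mirror image: the last turn \<open>q\<close> gives the length
  \<open>n + 2 - q\<close>.\<close>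

lemma last_length:
  assumes N: "length turns \<noteq> 0"
  shows "ind 3 (length_vector ts ! length turns) = turn (n - 1)" "ind 4 (length_vector ts ! length turns) = turn (n - 2)"
proof -
  let ?q = "turns ! (length turns - 1)"
  have q: "?q \<in> Q" "3 \<le> ?q" "?q < n" using Q_bounds turns_mem[of "length turns - 1"] N by auto
  have l: "length_vector ts ! length turns = n + 2 - ?q"
    unfolding length_vector_eq using N q by (simp add: seg_end_def seg_start_def del: upt_Suc)
  have le: "k \<le> ?q" if "k \<in> Q" for k using turns_next[OF that, of "length turns"] by force
  show "ind 3 (length_vector ts ! length turns) = turn (n - 1)"
  proof -
    have "n + 2 - ?q = 3 \<longleftrightarrow> ?q = n - 1" using q by auto
    moreover have "n - 1 \<in> Q \<longleftrightarrow> ?q = n - 1" using q le[of "n - 1"] by auto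
    ultimately show ?thesis by (simp add: l ind_def turn_def)
  qed
  have "n - 2 \<in> Q \<Longrightarrow> n - 1 \<notin> Q" using Q_gap[of "n - 2"] n4 by (simp add: Suc_diff_Suc numeral_2_eq_2)
  moreover have "n + 2 - ?q = 4 \<longleftrightarrow> ?q = n - 2" using q n4 by auto
  moreover have "?q = n - 1 \<or> ?q = n - 2 \<or> ?q < n - 2" using q by linarith
  ultimately show "ind 4 (length_vector ts ! length turns) = turn (n - 2)"
    using q le[of "n - 2"] by (auto simp: l ind_def turn_def)
qed

lemma sum_turn: "(\<Sum>k\<in>{3..<n}. turn k) = real (length turns)"
  using sum_turn_mult[of "\<lambda>_. 1"] by simp

end

theorem theorem2p1:
  fixes n :: nat and ts :: "(int \<times> int) set list" and \<theta> :: "nat \<Rightarrow> nat \<Rightarrow> real"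
  assumes "n \<ge> 4" and "ts \<in> TChains n"
    and "\<forall>a b. \<theta> a b = \<theta> b a" and "\<forall>a b. \<theta> a b \<ge> 0"
  shows "let l = length_vector ts; s = length l;
             \<eta> = (\<lambda>i. ind 3 (l ! (i - 1))); \<xi> = (\<lambda>i. ind 4 (l ! (i - 1)));
             \<sigma> = (\<lambda>i. ind 5 (l ! (i - 1)))
         in TI \<theta> ts =
            (if s = 1 then Lam0 \<theta> n + Lam3 \<theta>
             else if s = 2 then Lam0 \<theta> n + Lam1 \<theta> * (\<eta> 1 + \<eta> 2) + Lam2 \<theta> * (\<xi> 1 + \<xi> 2)
                                + 2 * Lam3 \<theta>
             else Lam0 \<theta> n + Lam1 \<theta> * (\<eta> 1 + \<eta> s) + Lam2 \<theta> * (\<xi> 1 + \<xi> s) + real s * Lam3 \<theta>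
                  + Lam4 \<theta> * (\<Sum>i=2..s-1. \<xi> i) + Lam5 \<theta> * (\<Sum>i=2..s-1. \<sigma> i))"
proof -
  obtain v Q where "labelled_chain ts n v Q"
    using ex_labelled_chain[of ts n] assms(1,2) unfolding TChains_def by auto
  then interpret labelled_chain ts n v Q .
  have s: "length (length_vector ts) = Suc (length turns)"
    by (simp add: length_vector_eq del: upt_Suc)
  have TI: "TI \<theta> ts = Lam0 \<theta> n + Lam1 \<theta> * (turn 3 + turn (n - 1)) + Lam2 \<theta> * (turn 4 + turn (n - 2))
    + (1 + real (length turns)) * Lam3 \<theta>
    + Lam4 \<theta> * (\<Sum>k\<in>{3..<n}. turn k * turn (k + 2)) + Lam5 \<theta> * (\<Sum>k\<in>{3..<n}. turn k * turn (k + 3))"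
    using TI_closed_form[of \<theta>] assms(3) by (simp add: sum_turn)
  show ?thesis
  proof (cases "length turns = 0")
    case True
    then have "k \<notin> Q" for k using set_turns by auto
    then have "turn k = 0" for k by (simp add: turn_def)
    then show ?thesis using TI True s by (simp add: Let_def)
  next
    case False
    have "TI \<theta> ts = Lam0 \<theta> n
      + Lam1 \<theta> * (ind 3 (length_vector ts ! 0) + ind 3 (length_vector ts ! length turns))
      + Lam2 \<theta> * (ind 4 (length_vector ts ! 0) + ind 4 (length_vector ts ! length turns))
      + (1 + real (length turns)) * Lam3 \<theta>
      + Lam4 \<theta> * (\<Sum>i=2..length turns. ind 4 (length_vector ts ! (i - 1)))
      + Lam5 \<theta> * (\<Sum>i=2..length turns. ind 5 (length_vector ts ! (i - 1)))"
      using sum_interior_lengths[OF False, of 2] sum_interior_lengths[OF False, of 3]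
      unfolding TI by (simp add: first_length[OF False] last_length[OF False])
    \<comment> \<open>For \<open>s = 2\<close> the interior sums run over the empty range from 2 to
      1, so one formula covers both remaining cases.\<close>
    then show ?thesis unfolding Let_def s using False by (auto simp: numeral_2_eq_2)
  qed
qed

end
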